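(* Let $\mathcal{A}$ be a sign pattern of order $n$, and let $A=[a_{ij}]\in Q(\mathcal{A})$ be a nilpotent matrix that allows a full-rank Jacobian. Let $j,k\in\{1,\dots,n\}$ with $j\neq k$ and suppose that $a_{jk}$ is non-Jacobian for some choice of $X_A$. Let $b$ be a nonzero real number. If $a_{kv}\neq 0$ and $\det A(j,v)\neq 0$ for some $v\in\{1,\dots,n\}$, then the matrix of order $n+1$ $$B=\left[\begin{array}{c|c} A-bP_{jk} & \mathbf{e}_j\\ \hline b\, r_k(A-bP_{jk}) & 0\end{array}\right]$$ is a nilpotent matrix that allows a full-rank Jacobian, and hence every superpattern of $\mathcal{B}=\operatorname{sgn}(B)$ is spectrally arbitrary.
   Context: All matrices are real. A sign pattern of order $n$ is an $n\times n$ matrix $\mathcal{A}=[\alpha_{ij}]$ with entries in $\{0,+,-\}$. $Q(\mathcal{A})$ is the set of real $n\times n$ matrices $A=[a_{ij}]$ with $a_{ij}=0$ if $\alpha_{ij}=0$, $a_{ij}>0$ if $\alpha_{ij}=+$, and $a_{ij}<0$ if $\alpha_{ij}=-$. If $A\in Q(\mathcal{A})$, write $\operatorname{sgn}(A)=\mathcal{A}$. A pattern $\mathcal{B}=[\beta_{ij}]$ is a superpattern of $\mathcal{A}=[\alpha_{ij}]$ (of the same order) if $\alpha_{ij}\neq 0$ implies $\beta_{ij}=\alpha_{ij}$. The characteristic polynomial of $A$ is $p_A(z)=\det(zI-A)$. A sign pattern $\mathcal{A}$ of order $n$ is spectrally arbitrary if for every monic real polynomial $p(z)$ of degree $n$ there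 is a matrix $A\in Q(\mathcal{A})$ with $p_A(z)=p(z)$. Full-rank Jacobian: let $A$ be a matrix of order $n$. Choose $m\ge n$ nonzero entries $a_{i_1j_1},\dots,a_{i_mj_m}$ of $A$ and let $X=X_A(x_1,\dots,x_m)$ be obtained from $A$ by replacing $a_{i_kj_k}$ with a variable $x_k$ for $k=1,\dots,m$ (all other entries are kept fixed). Write $p_X(z)=z^n+f_1z^{n-1}+\cdots+f_{n-1}z+f_n$ with $f_i=f_i(x_1,\dots,x_m)$, and let $J_{X=A}$ be the $n\times m$ matrix with $(i,j)$ entry $\partial f_i/\partial x_j$ evaluated at $(x_1,\dots,x_m)=(a_{i_1j_1},\dots,a_{i_mj_m})$. The nilpotent matrix $A$ allows a full-rank Jacobian if, for some such choice of entries, $J_{X=A}$ has rank $n$. When $J_{X=A}$ has rank $n$ for a given choice $X_A$, a nonzero entry of $A$ is called Jacobian in $X_A$ if it is replaced by a variable in $X_A$; otherwise the entry is non-Jacobian in $X_A$ (a non-Jacobian entry may be zero). Thus "$a_{jk}$ is non-Jacobian for some choice of $X_A$" means that there is a choice of $X_A$ with $J_{X=A}$ of rank $n$ in which position $(j,k)$ is not replaced by a variable. Notation: $r_k(M)$ is the $k$th row of $M$; $P_{jk}$ is the $n\times n$ matrix with a $1$ in entry $(j,k)$ and zeros elsewhere; $\mathbf{e}_j\in\mathbb{R}^n$ is the $j$th standard unit column vector; $A(u,v)$ is the matrix obtained from $A$ by deleting row $u$ and column $v$. *)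

theory Defs
  imports
    "HOL-Analysis.Analysis"
    "Jordan_Normal_Form.Char_Poly"
    "Jordan_Normal_Form.DL_Rank"
begin

datatype sgn_entry = Zero | Plus | Minus

definition sgn_of :: "real \<Rightarrow> sgn_entry" where
  "sgn_of x = (if x = 0 then Zero else if x > 0 then Plus else Minus)"

definition sgn_mat :: "real Matrix.mat \<Rightarrow> sgn_entry Matrix.mat" where
  "sgn_mat A = map_mat sgn_of A"

definition sign_pattern :: "nat \<Rightarrow> sgn_entry Matrix.mat \<Rightarrow> bool" where
  "sign_pattern n \<A> \<longleftrightarrow> \<A> \<in> carrier_mat n n"

definition qual_class :: "sgn_entry Matrix.mat \<Rightarrow> real Matrix.mat set" where
  "qual_class \<A> =
     {A \<in> carrier_mat (dim_row \<A>) (dim_col \<A>).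
        \<forall>i < dim_row \<A>. \<forall>j < dim_col \<A>.
          (\<A> $$ (i,j) = Zero \<longrightarrow> A $$ (i,j) = 0) \<and>
          (\<A> $$ (i,j) = Plus \<longrightarrow> A $$ (i,j) > 0) \<and>
          (\<A> $$ (i,j) = Minus \<longrightarrow> A $$ (i,j) < 0)}"

lemma qual_class_iff_sgn_mat: "A \<in> qual_class \<A> \<longleftrightarrow> sgn_mat A = \<A>"
proof
  assume "A \<in> qual_class \<A>"
  then have dim: "A \<in> carrier_mat (dim_row \<A>) (dim_col \<A>)"
    and e: "\<And>i j. i < dim_row \<A> \<Longrightarrow> j < dim_col \<A> \<Longrightarrow>
          (\<A> $$ (i,j) = Zero \<longrightarrow> A $$ (i,j) = 0) \<and>
          (\<A> $$ (i,j) = Plus \<longrightarrow> A $$ (i,j) > 0) \<and>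
          (\<A> $$ (i,j) = Minus \<longrightarrow> A $$ (i,j) < 0)"
    by (auto simp: qual_class_def)
  show "sgn_mat A = \<A>"
  proof (rule eq_matI)
    fix i j assume ij: "i < dim_row \<A>" "j < dim_col \<A>"
    then show "sgn_mat A $$ (i,j) = \<A> $$ (i,j)"
      using dim e[OF ij] by (cases "\<A> $$ (i,j)") (auto simp: sgn_mat_def sgn_of_def)
  qed (use dim in \<open>auto simp: sgn_mat_def\<close>)
next
  assume "sgn_mat A = \<A>"
  then show "A \<in> qual_class \<A>"
    by (auto simp: qual_class_def sgn_mat_def sgn_of_def split: if_splits)
qed

definition superpattern :: "sgn_entry Matrix.mat \<Rightarrow> sgn_entry Matrix.mat \<Rightarrow> bool" where
  "superpattern \<B> \<A> \<longleftrightarrow>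
     dim_row \<B> = dim_row \<A> \<and> dim_col \<B> = dim_col \<A> \<and>
     (\<forall>i < dim_row \<A>. \<forall>j < dim_col \<A>. \<A> $$ (i,j) \<noteq> Zero \<longrightarrow> \<B> $$ (i,j) = \<A> $$ (i,j))"

definition spectrally_arbitrary :: "nat \<Rightarrow> sgn_entry Matrix.mat \<Rightarrow> bool" where
  "spectrally_arbitrary n \<A> \<longleftrightarrow>
     sign_pattern n \<A> \<and>
     (\<forall>p :: real poly. degree p = n \<and> lead_coeff p = 1 \<longrightarrow>
        (\<exists>A \<in> qual_class \<A>. char_poly A = p))"

definition nilpotent_mat :: "nat \<Rightarrow> real Matrix.mat \<Rightarrow> bool" where
  "nilpotent_mat n A \<longleftrightarrow> A \<in> carrier_mat n n \<and> (\<exists>r. A ^\<^sub>m r = 0\<^sub>m n n)"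

text \<open>
  \<open>ps\<close> lists the (distinct) positions that are replaced by variables and \<open>xs\<close> the values
  of these variables: the entry at position \<open>ps ! l\<close> becomes \<open>xs ! l\<close>.
\<close>

definition var_mat ::
    "real Matrix.mat \<Rightarrow> (nat \<times> nat) list \<Rightarrow> real list \<Rightarrow> real Matrix.mat" where
  "var_mat A ps xs =
     Matrix.mat (dim_row A) (dim_col A)
       (\<lambda>p. case map_of (zip ps xs) p of Some x \<Rightarrow> x | None \<Rightarrow> A $$ p)"

text \<open>
  With indices counted from \<open>0\<close>, row \<open>i\<close> of the Jacobian belongs to the coefficient
  \<open>f\<^sub>i\<^sub>+\<^sub>1\<close> of \<open>z ^ (n - (i + 1))\<close>.
\<close>

definition jacobian :: "nat \<Rightarrow> real Matrix.mat \<Rightarrow> (nat \<times> nat) list \<Rightarrow> real Matrix.mat" where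
  "jacobian n A ps =
     (let as = map (\<lambda>p. A $$ p) ps in
      Matrix.mat n (length ps)
        (\<lambda>(i,l). deriv (\<lambda>t. coeff (char_poly (var_mat A ps (as[l := t]))) (n - Suc i)) (as ! l)))"

definition full_rank_choice :: "nat \<Rightarrow> real Matrix.mat \<Rightarrow> (nat \<times> nat) list \<Rightarrow> bool" where
  "full_rank_choice n A ps \<longleftrightarrow>
     distinct ps \<and> n \<le> length ps \<and>
     (\<forall>(i,j) \<in> set ps. i < n \<and> j < n \<and> A $$ (i,j) \<noteq> 0) \<and>
     vec_space.rank n (jacobian n A ps) = n"

definition allows_full_rank_jacobian :: "nat \<Rightarrow> real Matrix.mat \<Rightarrow> bool" where
  "allows_full_rank_jacobian n A \<longleftrightarrow> (\<exists>ps. full_rank_choice n A ps)"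

definition unit_entry_mat :: "nat \<Rightarrow> nat \<Rightarrow> nat \<Rightarrow> real Matrix.mat" where
  "unit_entry_mat n j k = Matrix.mat n n (\<lambda>p. if p = (j,k) then 1 else 0)"

definition bordered_mat ::
    "nat \<Rightarrow> real Matrix.mat \<Rightarrow> nat \<Rightarrow> nat \<Rightarrow> real \<Rightarrow> real Matrix.mat" where
  "bordered_mat n A j k b =
     (let C = A - b \<cdot>\<^sub>m unit_entry_mat n j k in
      four_block_mat C (mat_of_cols n [unit_vec n j])
        (mat_of_rows n [b \<cdot>\<^sub>v Matrix.row C k]) (0\<^sub>m 1 1))"

end

theory Submission
  imports Defs
begin

text \<open>
  Write \<open>R\<close> for the adjugate of \<open>z I - A\<close>. The determinant is affine in each single
  entry, so the derivative of the characteristic polynomial in the entry \<open>(u, v)\<close> is minus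
  the cofactor of \<open>z I - A\<close> at \<open>(u, v)\<close>, that is \<open>- R\<^sub>v\<^sub>u\<close>
  (\<open>char_poly_perturb\<close>). Full rank of the Jacobian therefore means that the cofactors at
  the chosen positions span all polynomials of degree below \<open>n\<close>
  (\<open>full_rank_jacobian_iff\<close>).

  Let \<open>B\<close> be the bordered matrix. Conjugation by a transvection in the new coordinate turns
  \<open>B\<close> into the block triangular matrix with blocks \<open>A\<close>, \<open>e\<^sub>j\<close>, \<open>0\<close>, \<open>0\<close>, so \<open>B\<close> is
  nilpotent (\<open>nilpotent_bordered\<close>). The cofactors of \<open>z I - B\<close> can be read off from those of
  \<open>z I - A\<close> (\<open>charcof_bordered\<close>): at an old position \<open>(u, v)\<close> with \<open>u \<noteq> k\<close> the
  cofactor is multiplied by \<open>z\<close>; at \<open>(k, v)\<close> it is multiplied by \<open>z\<close> and \<open>b\<close> times the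
  cofactor of \<open>A\<close> at \<open>(j, v)\<close> is subtracted; in the new row, at column \<open>v\<close>, it is the cofactor
  of \<open>A\<close> at \<open>(j, v)\<close>. Whenever the entry \<open>(k, v)\<close> is nonzero, so is the new entry below it,
  and the correction term is available. Hence the span for \<open>B\<close> contains \<open>z\<close> times the span for
  \<open>A\<close>, which is everything without constant term. The hypothesis on the column \<open>v\<close> supplies one
  more cofactor, the one of \<open>A\<close> at \<open>(j, v)\<close>, whose constant term is the nonzero number
  \<open>det A(j,v)\<close> up to sign. So all polynomials of degree at most \<open>n\<close> are reached
  (\<open>bordered_charcof_span\<close>).

  That every superpattern is then spectrally arbitrary is the nilpotent-Jacobian method
  (\<open>superpattern_spectrally_arbitrary\<close>). Give the additional nonzero entries a small fixed size
  \<open>\<epsilon>\<close>. Composing with a right inverse of the Jacobian, the map from entries to coefficients is,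
  near \<open>B\<close>, a perturbation of the identity by a function with Lipschitz constant at most \<open>1/2\<close>;
  and for small \<open>\<epsilon>\<close> it moves the coefficient vector \<open>0\<close> of \<open>z ^ m\<close> only a little, so its image
  contains a neighbourhood of \<open>0\<close>. Multiplying a
  matrix by a positive number \<open>c\<close> scales the coefficient of \<open>z ^ (m - i)\<close> by \<open>c ^ i\<close> and keeps all
  signs, so any monic polynomial can be moved into that neighbourhood. Solvability near the identity
  is a Picard iteration (\<open>near_identity_surj\<close>); the Lipschitz estimate comes from changing one entry
  at a time (\<open>multiaffine_increment\<close>) and the continuity of the cofactors (\<open>charcof_near\<close>).
\<close>

section \<open>The characteristic polynomial as a function of a single entry\<close>

text \<open>
  The entry at the transposed position of the adjugate of \<open>z I - A\<close>. The position is one argument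
  of product type so that families of positions can be summed over.
\<close>

definition charcof :: "'a::comm_ring_1 Matrix.mat \<Rightarrow> nat \<times> nat \<Rightarrow> 'a poly" where
  "charcof A p = cofactor (char_poly_matrix A) (fst p) (snd p)"

lemma char_poly_matrix_index:
  assumes "A \<in> carrier_mat n n" "i < n" "k < n"
  shows "char_poly_matrix A $$ (i, k) = (if i = k then [:0, 1:] else 0) - [:A $$ (i, k):]"
  using assms by (auto simp: char_poly_matrix_def)

lemma charcof_cong:
  assumes A: "A \<in> carrier_mat n n" and M: "M \<in> carrier_mat n n" and u: "u < n" and v: "v < n"
    and eq: "\<And>i k. i < n \<Longrightarrow> k < n \<Longrightarrow> i \<noteq> u \<Longrightarrow> k \<noteq> v \<Longrightarrow> M $$ (i, k) = A $$ (i, k)"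
  shows "charcof M (u, v) = charcof A (u, v)"
proof -
  have cA: "char_poly_matrix A \<in> carrier_mat n n" and cM: "char_poly_matrix M \<in> carrier_mat n n"
    using A M by auto
  have "mat_delete (char_poly_matrix M) u v = mat_delete (char_poly_matrix A) u v"
    using cA cM u v
    by (auto intro!: eq_matI simp: mat_delete_def char_poly_matrix_index[OF A]
        char_poly_matrix_index[OF M] eq)
  then show ?thesis
    by (simp add: charcof_def cofactor_def)
qed

lemma char_poly_row:
  assumes "A \<in> carrier_mat n n" "u < n"
  shows "char_poly A = (\<Sum>v<n. char_poly_matrix A $$ (u, v) * charcof A (u, v))"
  unfolding char_poly_def charcof_def
  using laplace_expansion_row[of "char_poly_matrix A" n u] assms by simp

text \<open>
  Expanding along row \<open>j\<close> with the entries of another row \<open>k\<close> gives the determinant of a matrix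
  with two equal rows, hence \<open>0\<close>; the term on the right is the contribution of the \<open>z\<close> on the
  diagonal of row \<open>k\<close>.
\<close>

lemma charcof_alien_row:
  assumes A: "A \<in> carrier_mat n n" and "j < n" "k < n" "j \<noteq> k"
  shows "(\<Sum>v<n. [:A $$ (k, v):] * charcof A (j, v)) = [:0, 1:] * charcof A (j, k)"
proof -
  let ?C = "char_poly_matrix A"
  have C: "?C \<in> carrier_mat n n" using A by simp
  have "0 = (?C * adj_mat ?C) $$ (k, j)"
    using adj_mat(2)[OF C] assms by simp
  also have "\<dots> = (\<Sum>v<n. ?C $$ (k, v) * charcof A (j, v))"
    using carrier_matD[OF C] assms by (simp add: scalar_prod_def adj_mat_def charcof_def lessThan_atLeast0)
  also have "\<dots> = (\<Sum>v<n. (if k = v then [:0, 1:] * charcof A (j, v) else 0)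
      - [:A $$ (k, v):] * charcof A (j, v))"
    by (intro sum.cong refl) (use assms in \<open>auto simp: char_poly_matrix_index left_diff_distrib
      simp del: mult_pCons_left\<close>)
  also have "\<dots> = [:0, 1:] * charcof A (j, k) - (\<Sum>v<n. [:A $$ (k, v):] * charcof A (j, v))"
    using assms by (simp add: sum_subtractf del: mult_pCons_left)
  finally show ?thesis by simp
qed

text \<open>
  Row \<open>u\<close> enters its own Laplace expansion only through the coefficients, not through the
  cofactors, so the characteristic polynomial is affine in each entry, with slope minus the cofactor.
\<close>

lemma char_poly_perturb:
  assumes A: "A \<in> carrier_mat n n" and M: "M \<in> carrier_mat n n" and u: "u < n" and v: "v < n"
    and eq: "\<And>i k. i < n \<Longrightarrow> k < n \<Longrightarrow> (i, k) \<noteq> (u, v) \<Longrightarrow> M $$ (i, k) = A $$ (i, k)"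
  shows "char_poly M = char_poly A - Polynomial.smult (M $$ (u, v) - A $$ (u, v)) (charcof A (u, v))"
proof -
  have cof: "charcof M (u, w) = charcof A (u, w)" if "w < n" for w
    by (rule charcof_cong[OF A M u that]) (auto intro: eq)
  have "char_poly M - char_poly A
      = (\<Sum>w<n. (char_poly_matrix M $$ (u, w) - char_poly_matrix A $$ (u, w)) * charcof A (u, w))"
    unfolding char_poly_row[OF A u] char_poly_row[OF M u] sum_subtractf[symmetric]
    by (intro sum.cong refl) (simp add: cof left_diff_distrib)
  also have "\<dots> = (\<Sum>w<n. if w = v then [:A $$ (u, v) - M $$ (u, v):] * charcof A (u, v) else 0)"
    by (intro sum.cong refl)
      (use u v eq in \<open>auto simp: char_poly_matrix_index[OF A] char_poly_matrix_index[OF M]\<close>)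
  also have "\<dots> = - Polynomial.smult (M $$ (u, v) - A $$ (u, v)) (charcof A (u, v))"
    using v by (simp add: smult_diff_left)
  finally show ?thesis by (simp add: algebra_simps)
qed

text \<open>
  The cofactor is a difference of two characteristic polynomials, both monic of degree \<open>n\<close>, so the
  leading terms cancel.
\<close>

lemma charcof_coeff_ge:
  fixes A :: "'a::idom Matrix.mat"
  assumes A: "A \<in> carrier_mat n n" and "u < n" "v < n" and i: "n \<le> i"
  shows "coeff (charcof A (u, v)) i = 0"
proof -
  let ?M = "Matrix.mat n n (\<lambda>p. A $$ p + (if p = (u, v) then 1 else 0))"
  have M: "?M \<in> carrier_mat n n" by simp
  have "char_poly ?M = char_poly A - Polynomial.smult (?M $$ (u, v) - A $$ (u, v)) (charcof A (u, v))"
    by (rule char_poly_perturb[OF A M]) (use assms in auto)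
  then have eq: "charcof A (u, v) = char_poly A - char_poly ?M"
    using assms by simp
  show ?thesis
    unfolding eq using degree_monic_char_poly[OF A] degree_monic_char_poly[OF M] i
    by (cases "i = n") (auto simp: coeff_eq_0)
qed

text \<open>
  At \<open>z = 0\<close> the cofactor is, up to sign, the corresponding minor of \<open>A\<close>.
\<close>

lemma charcof_coeff_0:
  fixes A :: "real Matrix.mat"
  assumes A: "A \<in> carrier_mat n n" and "u < n" "v < n"
    and "Determinant.det (mat_delete A u v) \<noteq> 0"
  shows "coeff (charcof A (u, v)) 0 \<noteq> 0"
proof -
  have D: "mat_delete A u v \<in> carrier_mat (n - 1) (n - 1)"
    using A by (rule mat_delete_carrier)
  have "poly (Determinant.det (mat_delete (char_poly_matrix A) u v)) 0
      = Determinant.det (- mat_delete A u v)"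
    by (rule poly_det_cong[of _ "n - 1"])
      (use assms in \<open>auto simp: mat_delete_def char_poly_matrix_def\<close>)
  moreover have "Determinant.det (- mat_delete A u v) \<noteq> 0"
    using det_0_negate[OF D] assms by simp
  ultimately show ?thesis
    by (simp add: charcof_def cofactor_def poly_0_coeff_0[symmetric])
qed

section \<open>Full-rank Jacobians and spanning cofactors\<close>

text \<open>
  The rank is the dimension of the column space, which is the image of the matrix. A maximal
  independent set of \<open>n\<close> columns is already a basis of the whole space.
\<close>

lemma full_rank_iff_surj:
  fixes J :: "real Matrix.mat"
  assumes J: "J \<in> carrier_mat n k"
  shows "vec_space.rank n J = n \<longleftrightarrow> (\<forall>y\<in>carrier_vec n. \<exists>x\<in>carrier_vec k. J *\<^sub>v x = y)"
proof -
  interpret vec_space "TYPE(real)" n .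
  let ?S = "set (cols J)"
  have S: "?S \<subseteq> carrier_vec n" "finite ?S" using J cols_dim by blast+
  have "col_space J = {y \<in> carrier_vec n. \<exists>x\<in>carrier_vec k. J *\<^sub>v x = y}"
    using col_space_eq[OF J] J by auto
  then have surj: "span ?S = carrier_vec n \<longleftrightarrow> (\<forall>y\<in>carrier_vec n. \<exists>x\<in>carrier_vec k. J *\<^sub>v x = y)"
    unfolding col_space_def by auto
  have "rank J = n \<longleftrightarrow> span ?S = carrier_vec n"
  proof
    assume rk: "rank J = n"
    obtain U where U: "maximal U (\<lambda>T. T \<subseteq> ?S \<and> lin_indpt T)"
      using maximal_exists[of "(\<lambda>T. T \<subseteq> ?S \<and> lin_indpt T)" "card ?S" "{}"]
      by (meson List.finite_set card_mono empty_iff empty_subsetI finite_lin_indpt2 rev_finite_subset)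
    then have US: "U \<subseteq> ?S" "lin_indpt U" by (auto simp: maximal_def)
    have "card U = n" using rank_card_indpt[OF J U] rk by simp
    then have "basis U"
      using US S by (intro dim_li_is_basis) (auto simp: dim_is_n intro: finite_subset)
    then have "span U = carrier_vec n" by (simp add: basis_def)
    moreover have "span U \<subseteq> span ?S" by (rule span_is_monotone[OF US(1)])
    moreover have "span ?S \<subseteq> carrier_vec n" using span_closed[OF S(1)] by auto
    ultimately show "span ?S = carrier_vec n" by blast
  next
    assume "span ?S = carrier_vec n"
    then have "span_vs ?S = V" by simp
    then show "rank J = n" unfolding rank_def by (simp add: dim_is_n)
  qed
  then show ?thesis using surj by simp
qed

lemma var_mat_carrier: "A \<in> carrier_mat n m \<Longrightarrow> var_mat A ps xs \<in> carrier_mat n m"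
  unfolding var_mat_def by (metis carrier_matD mat_carrier)

lemma coeff_char_poly_var_mat:
  fixes A :: "real Matrix.mat"
  assumes A: "A \<in> carrier_mat n n" and ps: "distinct ps" "set ps \<subseteq> {..<n} \<times> {..<n}" and l: "l < length ps"
  shows "coeff (char_poly (var_mat A ps ((map (\<lambda>p. A $$ p) ps)[l := t]))) i
    = coeff (char_poly A) i - (t - A $$ (ps ! l)) * coeff (charcof A (ps ! l)) i"
proof -
  have "ps ! l \<in> {..<n} \<times> {..<n}" using nth_mem[OF l] ps(2) by blast
  then obtain u v where uv: "ps ! l = (u, v)" "u < n" "v < n" by auto
  let ?xs = "(map (\<lambda>p. A $$ p) ps)[l := t]"
  have len: "length ps = length ?xs" by simp
  have M: "var_mat A ps ?xs \<in> carrier_mat n n" by (rule var_mat_carrier[OF A])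
  have look: "map_of (zip ps ?xs) p = Some (if p = ps ! l then t else A $$ p)" if p: "p \<in> set ps" for p
  proof -
    obtain k where k: "k < length ps" "p = ps ! k" using p unfolding in_set_conv_nth by auto
    then have "map_of (zip ps ?xs) p = Some (?xs ! k)"
      using map_of_zip_nth[OF len ps(1), of k] by simp
    moreover have "k = l \<longleftrightarrow> p = ps ! l"
      using k l ps(1) by (simp add: nth_eq_iff_index_eq)
    ultimately show ?thesis using k l by (auto simp: nth_list_update)
  qed
  have none: "map_of (zip ps ?xs) p = None" if "p \<notin> set ps" for p
    using that len by (simp add: map_of_zip_is_None)
  have ent: "var_mat A ps ?xs $$ p = (if p = ps ! l then t else A $$ p)" if "fst p < n" "snd p < n" for p
  proof -
    have "var_mat A ps ?xs $$ p = (case map_of (zip ps ?xs) p of Some x \<Rightarrow> x | None \<Rightarrow> A $$ p)"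
      unfolding var_mat_def using index_mat(1)[of "fst p" "dim_row A" "snd p" "dim_col A"] A that by simp
    then show ?thesis
      using look[of p] none[of p] nth_mem[OF l] by (cases "p \<in> set ps") auto
  qed
  have "char_poly (var_mat A ps ?xs) = char_poly A
      - Polynomial.smult (var_mat A ps ?xs $$ (u, v) - A $$ (u, v)) (charcof A (u, v))"
    by (rule char_poly_perturb[OF A M uv(2,3)]) (use ent uv in auto)
  then show ?thesis using ent[of "(u, v)"] uv by simp
qed

lemma jacobian_entry:
  fixes A :: "real Matrix.mat"
  assumes "A \<in> carrier_mat n n" "distinct ps" "set ps \<subseteq> {..<n} \<times> {..<n}" "l < length ps" "i < n"
  shows "jacobian n A ps $$ (i, l) = - coeff (charcof A (ps ! l)) (n - Suc i)"
proof -
  have "((\<lambda>t. coeff (char_poly A) (n - Suc i) - (t - A $$ (ps ! l)) * coeff (charcof A (ps ! l)) (n - Suc i))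
      has_field_derivative - coeff (charcof A (ps ! l)) (n - Suc i)) (at x)" for x
    by (auto intro!: derivative_eq_intros)
  then have *: "deriv (\<lambda>t. coeff (char_poly A) (n - Suc i) - (t - A $$ (ps ! l)) * coeff (charcof A (ps ! l)) (n - Suc i)) x
      = - coeff (charcof A (ps ! l)) (n - Suc i)" for x
    by (rule DERIV_imp_deriv)
  show ?thesis
    unfolding jacobian_def Let_def index_mat(1)[OF assms(5,4)] split
      coeff_char_poly_var_mat[OF assms(1-4)] by (rule *)
qed

text \<open>
  The columns of the Jacobian list the coefficients of the negated cofactors in descending order,
  and cofactors have degree below \<open>n\<close>; so spanning the column space and spanning the polynomials of
  degree below \<open>n\<close> are the same.
\<close>

lemma full_rank_jacobian_iff:
  fixes A :: "real Matrix.mat"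
  assumes A: "A \<in> carrier_mat n n" and ps: "distinct ps" "set ps \<subseteq> {..<n} \<times> {..<n}"
  shows "vec_space.rank n (jacobian n A ps) = n \<longleftrightarrow>
    (\<forall>q. (\<forall>i\<ge>n. coeff q i = 0) \<longrightarrow> (\<exists>c. q = (\<Sum>p\<in>set ps. Polynomial.smult (c p) (charcof A p))))"
    (is "_ \<longleftrightarrow> ?span")
proof -
  let ?J = "jacobian n A ps"
  let ?k = "length ps"
  have J: "?J \<in> carrier_mat n ?k" by (simp add: jacobian_def Let_def)
  have ent: "(?J *\<^sub>v x) $ i = - (\<Sum>l<?k. x $ l * coeff (charcof A (ps ! l)) (n - Suc i))"
    if "x \<in> carrier_vec ?k" "i < n" for x i
    using that carrier_matD[OF J]
    by (simp add: scalar_prod_def jacobian_entry[OF A ps] lessThan_atLeast0 mult.commute sum_negf)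
  have list: "(\<Sum>p\<in>set ps. h p) = (\<Sum>l<?k. h (ps ! l))" for h :: "nat \<times> nat \<Rightarrow> real"
    using sum.reindex_bij_betw[OF bij_betw_nth[OF ps(1) refl refl], of h] by simp
  have high: "coeff (charcof A p) i = 0" if "p \<in> set ps" "n \<le> i" for p i
    using that ps charcof_coeff_ge[OF A, of "fst p" "snd p" i] by auto
  show ?thesis
    unfolding full_rank_iff_surj[OF J]
  proof
    assume surj: "\<forall>y\<in>carrier_vec n. \<exists>x\<in>carrier_vec ?k. ?J *\<^sub>v x = y"
    show ?span
    proof (intro allI impI)
      fix q :: "real poly" assume q: "\<forall>i\<ge>n. coeff q i = 0"
      obtain x where x: "x \<in> carrier_vec ?k" and Jx: "?J *\<^sub>v x = vec n (\<lambda>i. - coeff q (n - Suc i))"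
        using surj vec_carrier by metis
      have "\<exists>c. \<forall>l<?k. c (ps ! l) = x $ l"
        by (rule exI[of _ "\<lambda>p. x $ (THE l. l < ?k \<and> ps ! l = p)"])
          (auto intro!: arg_cong[of _ _ "\<lambda>l. x $ l"] the_equality simp: nth_eq_iff_index_eq[OF ps(1)])
      then obtain c where c: "\<And>l. l < ?k \<Longrightarrow> c (ps ! l) = x $ l" by blast
      have "q = (\<Sum>p\<in>set ps. Polynomial.smult (c p) (charcof A p))"
      proof (rule poly_eqI)
        fix i
        show "coeff q i = coeff (\<Sum>p\<in>set ps. Polynomial.smult (c p) (charcof A p)) i"
        proof (cases "i < n")
          case True
          \<comment> \<open>row \<open>i'\<close> of the Jacobian holds the negated coefficients of \<open>z ^ i\<close>\<close>
          define i' where "i' = n - Suc i"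
          have i': "i' < n" "n - Suc i' = i" using True by (auto simp: i'_def)
          have "coeff q i = (\<Sum>l<?k. x $ l * coeff (charcof A (ps ! l)) i)"
            using arg_cong[OF Jx, of "\<lambda>w. w $ i'"] ent[OF x i'(1)] i' by simp
          then show ?thesis by (simp add: coeff_sum list c)
        next
          case False
          then show ?thesis using q high by (simp add: coeff_sum)
        qed
      qed
      then show "\<exists>c. q = (\<Sum>p\<in>set ps. Polynomial.smult (c p) (charcof A p))" by blast
    qed
  next
    assume span: ?span
    show "\<forall>y\<in>carrier_vec n. \<exists>x\<in>carrier_vec ?k. ?J *\<^sub>v x = y"
    proof
      fix y :: "real Matrix.vec" assume y: "y \<in> carrier_vec n"
      define q where "q = (\<Sum>i<n. monom (- (y $ (n - Suc i))) i)"
      have qi: "coeff q i = (if i < n then - (y $ (n - Suc i)) else 0)" for i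
        by (simp add: q_def coeff_sum)
      obtain c where c: "q = (\<Sum>p\<in>set ps. Polynomial.smult (c p) (charcof A p))"
        using span qi by force
      let ?x = "vec ?k (\<lambda>l. c (ps ! l))"
      have "?J *\<^sub>v ?x = y"
      proof (rule eq_vecI)
        fix i assume "i < dim_vec y"
        then have i: "i < n" using y by simp
        have "coeff q (n - Suc i) = (\<Sum>l<?k. c (ps ! l) * coeff (charcof A (ps ! l)) (n - Suc i))"
          by (simp add: c coeff_sum list)
        moreover have "coeff q (n - Suc i) = - (y $ i)" using i by (simp add: qi)
        ultimately show "(?J *\<^sub>v ?x) $ i = y $ i"
          using ent[of ?x i] i by simp
      qed (use y J in auto)
      then show "\<exists>x\<in>carrier_vec ?k. ?J *\<^sub>v x = y" by (intro bexI[of _ ?x]) auto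
    qed
  qed
qed

section \<open>Nilpotent matrices\<close>

text \<open>
  Over the complex numbers the characteristic polynomial splits. If \<open>a\<close> is a root with eigenvector
  \<open>v\<close>, then \<open>A ^ r = 0\<close> forces \<open>a ^ r\<close> times \<open>v\<close> to be \<open>0\<close>, so \<open>a = 0\<close>.
\<close>

lemma nilpotent_char_poly:
  assumes "nilpotent_mat n A"
  shows "char_poly A = monom 1 n"
proof -
  obtain r where A: "A \<in> carrier_mat n n" and r: "A ^\<^sub>m r = 0\<^sub>m n n"
    using assms by (auto simp: nilpotent_mat_def)
  let ?C = "map_mat complex_of_real A"
  have C: "?C \<in> carrier_mat n n" using A by simp
  have C0: "?C ^\<^sub>m r = 0\<^sub>m n n"
  proof -
    have "?C ^\<^sub>m r = map_mat complex_of_real (0\<^sub>m n n)"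
      using of_real_hom.mat_hom_pow[OF A, of r, symmetric] by (simp only: r)
    also have "\<dots> = 0\<^sub>m n n" by (intro eq_matI) auto
    finally show ?thesis .
  qed
  obtain as where as: "char_poly ?C = (\<Prod>a\<leftarrow>as. [:- a, 1:])" "length as = n"
    using char_poly_factorized[OF C] by blast
  have "a = 0" if "a \<in> set as" for a
  proof -
    have "poly (char_poly ?C) a = 0"
      unfolding as(1) poly_prod_list using that by (auto simp: prod_list_zero_iff)
    then obtain v where v: "eigenvector ?C v a"
      using eigenvalue_root_char_poly[OF C] by (auto simp: eigenvalue_def)
    then have vc: "v \<in> carrier_vec n" "v \<noteq> 0\<^sub>v n" using C by (auto simp: eigenvector_def)
    have "a ^ r \<cdot>\<^sub>v v = 0\<^sub>v n"
    proof -
      have "a ^ r \<cdot>\<^sub>v v = 0\<^sub>m n n *\<^sub>v v"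
        using eigenvector_pow[OF C v, of r] unfolding C0 ..
      also have "\<dots> = 0\<^sub>v n"
        using vc by (intro eq_vecI) (auto simp: scalar_prod_def)
      finally show ?thesis .
    qed
    moreover obtain i where "i < n" "v $ i \<noteq> 0"
      using vc by (metis eq_vecI carrier_vecD index_zero_vec)
    ultimately have "a ^ r = 0"
      using vc by (metis carrier_vecD index_smult_vec(1) index_zero_vec(1) mult_eq_0_iff)
    then show "a = 0" by simp
  qed
  then have "map (\<lambda>a. [:- a, 1:]) as = replicate n [:0, 1:]"
    using as(2) by (intro nth_equalityI) auto
  then have C_monom: "char_poly ?C = monom 1 n"
    unfolding as(1) by (simp add: prod_list_replicate monom_altdef)
  have "map_poly complex_of_real (char_poly A) = monom 1 n"
    unfolding of_real_hom.char_poly_hom[OF A, symmetric] by (rule C_monom)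
  then have "coeff (map_poly complex_of_real (char_poly A)) i = coeff (monom 1 n) i" for i
    by simp
  then have "complex_of_real (coeff (char_poly A) i) = (if n = i then 1 else 0)" for i
    by (simp add: coeff_map_poly)
  then have "coeff (char_poly A) i = (if n = i then 1 else 0)" for i
    by (metis of_real_eq_0_iff of_real_eq_1_iff)
  then show ?thesis
    by (intro poly_eqI) simp
qed

section \<open>Continuity of the cofactors\<close>

lemma tendsto_coeff_prod:
  fixes f :: "'b \<Rightarrow> 'c \<Rightarrow> real poly"
  assumes "finite I" and "\<And>x i. x \<in> I \<Longrightarrow> ((\<lambda>s. coeff (f s x) i) \<longlongrightarrow> coeff (g x) i) F"
  shows "((\<lambda>s. coeff (\<Prod>x\<in>I. f s x) i) \<longlongrightarrow> coeff (\<Prod>x\<in>I. g x) i) F"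
  using assms
  by (induction I arbitrary: i rule: finite_induct) (auto simp: coeff_mult intro!: tendsto_intros)

lemma tendsto_coeff_det:
  fixes X :: "'b \<Rightarrow> real poly Matrix.mat"
  assumes X: "\<And>s. X s \<in> carrier_mat n n" and Y: "Y \<in> carrier_mat n n"
    and lim: "\<And>u v i. u < n \<Longrightarrow> v < n \<Longrightarrow> ((\<lambda>s. coeff (X s $$ (u, v)) i) \<longlongrightarrow> coeff (Y $$ (u, v)) i) F"
  shows "((\<lambda>s. coeff (Determinant.det (X s)) i) \<longlongrightarrow> coeff (Determinant.det Y) i) F"
proof -
  have *: "((\<lambda>s. coeff (signof \<pi> * (\<Prod>u = 0..<n. X s $$ (u, \<pi> u))) i)
      \<longlongrightarrow> coeff (signof \<pi> * (\<Prod>u = 0..<n. Y $$ (u, \<pi> u))) i) F" if p: "\<pi> permutes {0..<n}" for \<pi>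
  proof -
    have "((\<lambda>s. coeff (\<Prod>u = 0..<n. X s $$ (u, \<pi> u)) i)
      \<longlongrightarrow> coeff (\<Prod>u = 0..<n. Y $$ (u, \<pi> u)) i) F"
      by (rule tendsto_coeff_prod) (use p permutes_in_image[OF p] in \<open>auto intro!: lim\<close>)
    then show ?thesis
      by (cases \<pi> rule: sign_cases) (auto intro: tendsto_minus)
  qed
  show ?thesis
    unfolding det_def'[OF X] det_def'[OF Y] coeff_sum
    by (intro tendsto_sum *) auto
qed

text \<open>
  A coefficient of a cofactor is a polynomial in the entries of the matrix, hence continuous in them.
\<close>

lemma tendsto_coeff_charcof:
  fixes X :: "'b \<Rightarrow> real Matrix.mat"
  assumes X: "\<And>s. X s \<in> carrier_mat n n" and Y: "Y \<in> carrier_mat n n"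
    and lim: "\<And>u v. u < n \<Longrightarrow> v < n \<Longrightarrow> ((\<lambda>s. X s $$ (u, v)) \<longlongrightarrow> Y $$ (u, v)) F"
    and p: "fst p < n" "snd p < n"
  shows "((\<lambda>s. coeff (charcof (X s) p) i) \<longlongrightarrow> coeff (charcof Y p) i) F"
proof -
  have *: "((\<lambda>s. coeff (char_poly_matrix (X s) $$ (u, v)) i)
      \<longlongrightarrow> coeff (char_poly_matrix Y $$ (u, v)) i) F" if "u < n" "v < n" for u v i
    by (cases i) (auto simp: char_poly_matrix_index[OF X that] char_poly_matrix_index[OF Y that]
      intro!: tendsto_intros lim that)
  have c: "char_poly_matrix (X s) \<in> carrier_mat n n" "char_poly_matrix Y \<in> carrier_mat n n" for s
    using X Y by auto
  obtain u v where uv: "p = (u, v)" by (cases p)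
  have "((\<lambda>s. coeff (Determinant.det (mat_delete (char_poly_matrix (X s)) u v)) i)
      \<longlongrightarrow> coeff (Determinant.det (mat_delete (char_poly_matrix Y) u v)) i) F"
  proof (rule tendsto_coeff_det[where n = "n - 1"])
    fix a b i assume "a < n - 1" "b < n - 1"
    then show "((\<lambda>s. coeff (mat_delete (char_poly_matrix (X s)) u v $$ (a, b)) i)
      \<longlongrightarrow> coeff (mat_delete (char_poly_matrix Y) u v $$ (a, b)) i) F"
      using carrier_matD[OF c(1)] carrier_matD[OF c(2)] by (auto simp: mat_delete_def intro!: *)
  qed (use mat_delete_carrier[OF c(1)] mat_delete_carrier[OF c(2)] in auto)
  then have "((\<lambda>s. (-1)^(u + v) * coeff (Determinant.det (mat_delete (char_poly_matrix (X s)) u v)) i)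
      \<longlongrightarrow> (-1)^(u + v) * coeff (Determinant.det (mat_delete (char_poly_matrix Y) u v)) i) F"
    by (intro tendsto_intros)
  moreover have "coeff ((-1)^k * q) i = (-1)^k * coeff q i" for k and q :: "real poly"
    by (cases "even k") auto
  ultimately show ?thesis
    by (simp add: charcof_def cofactor_def uv)
qed

text \<open>
  Uniform form of the continuity at \<open>B\<close>. Matrices are indexed functions here, because later
  arguments change them one entry at a time.
\<close>

lemma charcof_near:
  fixes B :: "real Matrix.mat"
  assumes B: "B \<in> carrier_mat m m" and \<kappa>: "\<kappa> > 0"
  obtains \<rho> where "\<rho> > 0"
    "\<And>G p i. \<lbrakk>\<And>q. q \<in> {..<m} \<times> {..<m} \<Longrightarrow> \<bar>G q - B $$ q\<bar> \<le> \<rho>; p \<in> {..<m} \<times> {..<m}; i < m\<rbrakk> \<Longrightarrow>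
      \<bar>coeff (charcof (Matrix.mat m m G) p) i - coeff (charcof B p) i\<bar> \<le> \<kappa>"
proof (rule ccontr)
  let ?P = "{..<m} \<times> {..<m}"
  assume "\<not> thesis"
  with that have "\<forall>\<rho>>0. \<exists>G p i. (\<forall>q\<in>?P. \<bar>G q - B $$ q\<bar> \<le> \<rho>) \<and> p \<in> ?P \<and> i < m \<and>
      \<kappa> < \<bar>coeff (charcof (Matrix.mat m m G) p) i - coeff (charcof B p) i\<bar>"
    by (metis not_less)
  then have "\<forall>s. \<exists>G p i. (\<forall>q\<in>?P. \<bar>G q - B $$ q\<bar> \<le> inverse (real (Suc s))) \<and> p \<in> ?P \<and> i < m \<and>
      \<kappa> < \<bar>coeff (charcof (Matrix.mat m m G) p) i - coeff (charcof B p) i\<bar>"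
    by simp
  then obtain G p i where G: "\<And>s q. q \<in> ?P \<Longrightarrow> \<bar>G s q - B $$ q\<bar> \<le> inverse (real (Suc s))"
    and p: "\<And>s. p s \<in> ?P" and i: "\<And>s. i s < m"
    and big: "\<And>s. \<kappa> < \<bar>coeff (charcof (Matrix.mat m m (G s)) (p s)) (i s) - coeff (charcof B (p s)) (i s)\<bar>"
    by metis
  \<comment> \<open>The offending position and coefficient vary with \<open>s\<close>; summing the errors over all of the finitely
    many candidates gives one sequence that tends to \<open>0\<close> and stays above \<open>\<kappa>\<close>.\<close>
  define e where "e s p i = \<bar>coeff (charcof (Matrix.mat m m (G s)) p) i - coeff (charcof B p) i\<bar>" for s p i
  have lim: "(\<lambda>s. Matrix.mat m m (G s) $$ (u, v)) \<longlonglongrightarrow> B $$ (u, v)" if "u < m" "v < m" for u v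
  proof -
    have "(\<lambda>s. G s (u, v) - B $$ (u, v)) \<longlonglongrightarrow> 0"
      by (rule Lim_null_comparison[OF _ LIMSEQ_inverse_real_of_nat]) (use G that in auto)
    then show ?thesis using that by (simp add: LIM_zero_iff)
  qed
  have "(\<lambda>s. e s p i) \<longlonglongrightarrow> \<bar>coeff (charcof B p) i - coeff (charcof B p) i\<bar>" if "p \<in> ?P" for p i
    unfolding e_def
    by (intro tendsto_intros tendsto_coeff_charcof[where n = m] lim B) (use that in auto)
  then have "(\<lambda>s. \<Sum>p\<in>?P. \<Sum>i<m. e s p i) \<longlonglongrightarrow> (\<Sum>p\<in>?P. \<Sum>i<m. 0)"
    by (intro tendsto_sum) auto
  then have "(\<lambda>s. \<Sum>p\<in>?P. \<Sum>i<m. e s p i) \<longlonglongrightarrow> 0" by simp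
  then have "eventually (\<lambda>s. (\<Sum>p\<in>?P. \<Sum>i<m. e s p i) < \<kappa>) sequentially"
    using \<kappa> by (rule order_tendstoD(2))
  then obtain s where s: "(\<Sum>p\<in>?P. \<Sum>i<m. e s p i) < \<kappa>"
    by (auto simp: eventually_sequentially)
  have "e s (p s) (i s) \<le> (\<Sum>i<m. e s (p s) i)"
    by (rule member_le_sum[where f = "e s (p s)"]) (use i in \<open>auto simp: e_def\<close>)
  also have "\<dots> \<le> (\<Sum>p\<in>?P. \<Sum>i<m. e s p i)"
    by (rule member_le_sum[where f = "\<lambda>p. \<Sum>i<m. e s p i"])
      (use p in \<open>auto simp: e_def intro!: sum_nonneg\<close>)
  finally show False
    using big[of s] s by (simp add: e_def)
qed

section \<open>The nilpotent-Jacobian method\<close>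

text \<open>
  A mean value estimate without calculus. Passing from \<open>G\<close> to \<open>G'\<close> one coordinate at a time, each
  step is exactly affine with some slope \<open>g p Z\<close> taken at a hybrid point \<open>Z\<close> of \<open>G\<close> and \<open>G'\<close>. If
  all these slopes are within \<open>\<kappa>\<close> of \<open>d p\<close>, the total increment is close to the linear one.
\<close>

lemma multiaffine_increment:
  fixes f :: "('p \<Rightarrow> real) \<Rightarrow> real"
  assumes "finite P"
    and aff: "\<And>Z p t. p \<in> P \<Longrightarrow> f (Z(p := t)) = f Z + (t - Z p) * g p Z"
    and off: "\<And>p. p \<notin> P \<Longrightarrow> G' p = G p"
    and bd: "\<And>p Z. p \<in> P \<Longrightarrow> (\<And>q. Z q \<in> {G q, G' q}) \<Longrightarrow> \<bar>g p Z - d p\<bar> \<le> \<kappa>"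
  shows "\<bar>f G' - f G - (\<Sum>p\<in>P. (G' p - G p) * d p)\<bar> \<le> \<kappa> * (\<Sum>p\<in>P. \<bar>G' p - G p\<bar>)"
  using assms
proof (induction P arbitrary: G' rule: finite_induct)
  case empty
  then have "G' = G" by auto
  then show ?case by simp
next
  case (insert p P)
  define G'' where "G'' = G'(p := G p)"
  have *: "\<bar>f G'' - f G - (\<Sum>q\<in>P. (G'' q - G q) * d q)\<bar> \<le> \<kappa> * (\<Sum>q\<in>P. \<bar>G'' q - G q\<bar>)"
  proof (rule insert.IH)
    fix q Z assume q: "q \<in> P" and "\<And>q. Z q \<in> {G q, G'' q}"
    then have "Z x \<in> {G x, G' x}" for x
      by (metis G''_def fun_upd_apply insertCI insertE singletonD)
    with q show "\<bar>g q Z - d q\<bar> \<le> \<kappa>" by (intro insert.prems) auto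
  qed (use insert.prems in \<open>auto simp: G''_def\<close>)
  have s: "(\<Sum>q\<in>P. (G'' q - G q) * d q) = (\<Sum>q\<in>P. (G' q - G q) * d q)"
    "(\<Sum>q\<in>P. \<bar>G'' q - G q\<bar>) = (\<Sum>q\<in>P. \<bar>G' q - G q\<bar>)"
    using insert.hyps by (auto intro!: sum.cong simp: G''_def)
  have "f G' = f (G''(p := G' p))" by (simp add: G''_def)
  also have "\<dots> = f G'' + (G' p - G p) * g p G''"
    using insert.prems(1)[of p G'' "G' p"] by (simp only: G''_def insertI1 fun_upd_same)
  finally have f: "f G' = f G'' + (G' p - G p) * g p G''" .
  have "\<bar>g p G'' - d p\<bar> \<le> \<kappa>"
    by (rule insert.prems) (auto simp: G''_def)
  then have "\<bar>G' p - G p\<bar> * \<bar>g p G'' - d p\<bar> \<le> \<bar>G' p - G p\<bar> * \<kappa>"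
    by (intro mult_left_mono) auto
  then have "\<bar>(G' p - G p) * g p G'' - (G' p - G p) * d p\<bar> \<le> \<kappa> * \<bar>G' p - G p\<bar>"
    by (simp add: abs_mult[symmetric] right_diff_distrib mult.commute)
  with * show ?case
    unfolding sum.insert[OF insert.hyps] f s distrib_left by linarith
qed

text \<open>
  Solving \<open>H y = q\<close> means finding a fixed point of \<open>y \<mapsto> y - H y + q\<close>, which is a contraction with
  factor \<open>1/2\<close> on the cube of radius \<open>r\<close>. The iterates started at \<open>0\<close> have steps at most
  \<open>r/2, r/4, \<dots>\<close> and thus never leave the cube.
\<close>

lemma near_identity_surj:
  fixes H :: "(nat \<Rightarrow> real) \<Rightarrow> nat \<Rightarrow> real"
  assumes r: "r > 0"
    and lip: "\<And>y y' d i. (\<And>i. i < m \<Longrightarrow> \<bar>y i\<bar> \<le> r) \<Longrightarrow> (\<And>i. i < m \<Longrightarrow> \<bar>y' i\<bar> \<le> r) \<Longrightarrow>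
        (\<And>i. i < m \<Longrightarrow> \<bar>y i - y' i\<bar> \<le> d) \<Longrightarrow> i < m \<Longrightarrow>
        \<bar>(H y i - y i) - (H y' i - y' i)\<bar> \<le> d / 2"
    and q: "\<And>i. i < m \<Longrightarrow> \<bar>q i - H (\<lambda>_. 0) i\<bar> \<le> r / 2"
  shows "\<exists>y. (\<forall>i<m. \<bar>y i\<bar> \<le> r) \<and> (\<forall>i<m. H y i = q i)"
proof -
  define \<Psi> where "\<Psi> y i = y i - H y i + q i" for y i
  define Y where "Y s = (\<Psi> ^^ s) (\<lambda>_. 0)" for s
  have Y0: "Y 0 = (\<lambda>_. 0)" and YS: "Y (Suc s) = \<Psi> (Y s)" for s
    by (auto simp: Y_def)
  have contr: "\<bar>\<Psi> y i - \<Psi> y' i\<bar> \<le> d / 2"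
    if "\<And>i. i < m \<Longrightarrow> \<bar>y i\<bar> \<le> r" "\<And>i. i < m \<Longrightarrow> \<bar>y' i\<bar> \<le> r"
      "\<And>i. i < m \<Longrightarrow> \<bar>y i - y' i\<bar> \<le> d" "i < m" for y y' d i
    using lip[of y y' d i, OF that] unfolding \<Psi>_def by linarith
  have inv: "\<forall>i<m. \<bar>Y s i\<bar> \<le> r * (1 - (1/2)^s) \<and> \<bar>Y (Suc s) i - Y s i\<bar> \<le> r * (1/2)^(Suc s)" for s
  proof (induction s)
    case 0
    then show ?case using q by (auto simp: YS Y0 \<Psi>_def abs_minus_commute)
  next
    case (Suc s)
    have le: "r * (1 - (1/2)^s) \<le> r" for s using r by simp
    have b: "\<bar>Y (Suc s) i\<bar> \<le> r * (1 - (1/2)^(Suc s))" if "i < m" for i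
    proof -
      have "\<bar>Y (Suc s) i\<bar> \<le> \<bar>Y s i\<bar> + \<bar>Y (Suc s) i - Y s i\<bar>" by linarith
      also have "\<dots> \<le> r * (1 - (1/2)^s) + r * (1/2)^(Suc s)"
        using Suc that by (intro add_mono) auto
      also have "\<dots> = r * (1 - (1/2)^(Suc s))" by (simp add: algebra_simps)
      finally show ?thesis .
    qed
    have "\<bar>\<Psi> (Y (Suc s)) i - \<Psi> (Y s) i\<bar> \<le> r * (1/2)^(Suc s) / 2" if "i < m" for i
      by (rule contr) (use b Suc that order_trans[OF _ le] in blast)+
    with b show ?case by (simp add: YS[of "Suc s"] YS[of s])
  qed
  have Yr: "\<bar>Y s i\<bar> \<le> r" if "i < m" for s i
  proof -
    have "r * (1 - (1/2)^s) \<le> r" using r by simp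
    then show ?thesis using inv[of s] that by fastforce
  qed
  define y where "y i = (\<Sum>s. Y (Suc s) i - Y s i)" for i
  have lim: "(\<lambda>s. Y s i) \<longlonglongrightarrow> y i" if "i < m" for i
  proof -
    have "summable (\<lambda>s. r / 2 * (1/2::real)^s)"
      by (intro summable_mult summable_geometric) simp
    then have "summable (\<lambda>s. Y (Suc s) i - Y s i)"
      by (rule summable_comparison_test'[where N = 0]) (use inv that in auto)
    then have "(\<lambda>s. \<Sum>t<s. Y (Suc t) i - Y t i) \<longlonglongrightarrow> y i"
      unfolding y_def by (rule summable_LIMSEQ)
    moreover have "(\<Sum>t<s. Y (Suc t) i - Y t i) = Y s i" for s
      by (induction s) (auto simp: Y0)
    ultimately show ?thesis by simp
  qed
  have yr: "\<bar>y i\<bar> \<le> r" if "i < m" for i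
    by (rule LIMSEQ_le_const2[OF tendsto_rabs[OF lim[OF that]]]) (use Yr that in blast)
  have "H y i = q i" if i: "i < m" for i
  proof -
    let ?d = "\<lambda>s. \<Sum>l<m. \<bar>Y s l - y l\<bar>"
    have d0: "?d \<longlonglongrightarrow> (\<Sum>l<m. \<bar>y l - y l\<bar>)"
      by (intro tendsto_intros lim) auto
    have "\<bar>\<Psi> (Y s) i - \<Psi> y i\<bar> \<le> ?d s / 2" for s
      by (rule contr) (use i Yr yr in \<open>auto intro: member_le_sum[where f = "\<lambda>l. \<bar>Y s l - y l\<bar>"]\<close>)
    moreover have "(\<lambda>s. ?d s / 2) \<longlonglongrightarrow> 0"
      using tendsto_divide[OF d0 tendsto_const[of 2]] by simp
    ultimately have "(\<lambda>s. \<Psi> (Y s) i - \<Psi> y i) \<longlonglongrightarrow> 0"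
      by (metis (mono_tags, lifting) Lim_null_comparison always_eventually real_norm_def)
    then have "(\<lambda>s. \<Psi> (Y s) i) \<longlonglongrightarrow> \<Psi> y i"
      by (simp add: LIM_zero_iff)
    moreover have "(\<lambda>s. \<Psi> (Y s) i) \<longlonglongrightarrow> y i"
      using LIMSEQ_Suc[OF lim[OF i]] by (simp add: YS)
    ultimately have "\<Psi> y i = y i" by (rule LIMSEQ_unique)
    then show ?thesis by (simp add: \<Psi>_def)
  qed
  with yr show ?thesis by blast
qed

text \<open>
  Substituting \<open>c z\<close> for \<open>z\<close> in \<open>det (z I - c A)\<close> pulls out the factor \<open>c ^ n\<close>.
\<close>

lemma coeff_char_poly_smult:
  fixes A :: "real Matrix.mat"
  assumes A: "A \<in> carrier_mat n n" and c: "c \<noteq> 0" and i: "i \<le> n"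
  shows "coeff (char_poly (c \<cdot>\<^sub>m A)) i = c ^ (n - i) * coeff (char_poly A) i"
proof -
  have cA: "c \<cdot>\<^sub>m A \<in> carrier_mat n n" using A by simp
  have "char_poly (c \<cdot>\<^sub>m A) \<circ>\<^sub>p [:0, c:] = Polynomial.smult (c ^ n) (char_poly A)"
  proof (rule iffD1[OF poly_eq_poly_eq_iff], rule ext)
    fix x :: real
    have *: "- char_matrix (c \<cdot>\<^sub>m A) (c * x) = c \<cdot>\<^sub>m (- char_matrix A x)"
      using A by (intro eq_matI) (auto simp: char_matrix_def algebra_simps)
    show "poly (char_poly (c \<cdot>\<^sub>m A) \<circ>\<^sub>p [:0, c:]) x = poly (Polynomial.smult (c ^ n) (char_poly A)) x"
      using A by (simp add: poly_pcompose char_poly_matrix[OF cA] char_poly_matrix[OF A] mult.commute[of x] *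
          carrier_matD[OF char_matrix_closed[OF A]])
  qed
  then have "c ^ i * coeff (char_poly (c \<cdot>\<^sub>m A)) i = c ^ n * coeff (char_poly A) i"
    by (metis coeff_pcompose_linear coeff_smult)
  also have "c ^ n = c ^ i * c ^ (n - i)" using i by (simp add: power_add[symmetric])
  finally show ?thesis using c by simp
qed

text \<open>
  The nilpotent-Jacobian theorem. Its two ingredients are a local surjectivity statement near \<open>B\<close>,
  uniform enough to leave room for the additional entries \<open>\<epsilon> E\<close> of the superpattern, and the
  rescaling of matrices. The spanning hypothesis provides the right inverse \<open>L\<close> of the derivative
  of the coefficient map, supported on the nonzero positions of \<open>B\<close> so that small multiples of it do
  not change any sign.
\<close>

lemma superpattern_spectrally_arbitrary:
  fixes B :: "real Matrix.mat"
  assumes m: "m > 0" and B: "B \<in> carrier_mat m m" and chi: "char_poly B = monom 1 m"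
    and span: "\<And>q. (\<And>i. m \<le> i \<Longrightarrow> coeff q i = 0) \<Longrightarrow>
      \<exists>c. q = (\<Sum>p\<in>{p \<in> {..<m} \<times> {..<m}. B $$ p \<noteq> 0}. Polynomial.smult (c p) (charcof B p))"
    and sup: "superpattern \<S> (sgn_mat B)"
  shows "spectrally_arbitrary m \<S>"
proof -
  define P where "P = {..<m} \<times> {..<m}"
  define N where "N = {p \<in> P. B $$ p \<noteq> 0}"
  have fin: "finite P" "finite N" and NP: "N \<subseteq> P" by (auto simp: P_def N_def)
  have "\<exists>c. monom 1 i = (\<Sum>p\<in>N. Polynomial.smult (c p) (charcof B p))" if "i < m" for i
    using span[of "monom 1 i"] that by (simp add: N_def P_def)
  then obtain c where c: "\<And>i. i < m \<Longrightarrow> monom 1 i = (\<Sum>p\<in>N. Polynomial.smult (c i p) (charcof B p))"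
    by metis
  define L where "L y p = (if p \<in> N then - (\<Sum>i<m. y i * c i p) else 0)" for y p
  define E :: "nat \<times> nat \<Rightarrow> real" where
    "E p = (if p \<in> P - N then (case \<S> $$ p of Zero \<Rightarrow> 0 | Plus \<Rightarrow> 1 | Minus \<Rightarrow> -1) else 0)" for p
  have E1: "\<bar>E p\<bar> \<le> 1" for p by (auto simp: E_def split: sgn_entry.splits)
  define X where "X \<epsilon> y p = B $$ p + L y p + \<epsilon> * E p" for \<epsilon> y p
  define f :: "nat \<Rightarrow> (nat \<times> nat \<Rightarrow> real) \<Rightarrow> real" where "f i G = coeff (char_poly (Matrix.mat m m G)) i" for i G
  define g :: "nat \<Rightarrow> nat \<times> nat \<Rightarrow> (nat \<times> nat \<Rightarrow> real) \<Rightarrow> real" where "g i p G = - coeff (charcof (Matrix.mat m m G) p) i" for i p G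
  define d where "d i p = - coeff (charcof B p) i" for i p
  define K where "K = 1 + (\<Sum>p\<in>N. \<Sum>i<m. \<bar>c i p\<bar>)"
  have K: "K > 0" unfolding K_def by (intro add_pos_nonneg sum_nonneg) auto
  have L_le: "\<bar>L y p\<bar> \<le> K * e" if y: "\<And>i. i < m \<Longrightarrow> \<bar>y i\<bar> \<le> e" for y e p
  proof (cases "p \<in> N")
    case True
    have e: "e \<ge> 0" using y[OF m] by linarith
    have "\<bar>L y p\<bar> \<le> (\<Sum>i<m. \<bar>y i * c i p\<bar>)"
      using True by (simp add: L_def sum_abs)
    also have "\<dots> \<le> (\<Sum>i<m. e * \<bar>c i p\<bar>)"
      using y by (intro sum_mono) (auto simp: abs_mult intro: mult_right_mono)
    also have "\<dots> = (\<Sum>i<m. \<bar>c i p\<bar>) * e" by (simp add: sum_distrib_left mult.commute)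
    also have "\<dots> \<le> K * e"
    proof (rule mult_right_mono[OF _ e])
      have "(\<Sum>i<m. \<bar>c i p\<bar>) \<le> (\<Sum>p\<in>N. \<Sum>i<m. \<bar>c i p\<bar>)"
        by (rule member_le_sum[OF True]) (use fin in \<open>auto intro: sum_nonneg\<close>)
      then show "(\<Sum>i<m. \<bar>c i p\<bar>) \<le> K" by (simp add: K_def)
    qed
    finally show ?thesis .
  next
    case False
    have "0 \<le> e" using y[OF m] by linarith
    with K False show ?thesis by (simp add: L_def)
  qed
  have L_diff: "L y p - L y' p = L (\<lambda>i. y i - y' i) p" for y y' p
    by (simp add: L_def sum_subtractf left_diff_distrib)
  have deriv_L: "(\<Sum>p\<in>P. L y p * d i p) = y i" if i: "i < m" for y i
  proof -
    have "(\<Sum>p\<in>P. L y p * d i p) = (\<Sum>p\<in>N. L y p * d i p)"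
      by (rule sum.mono_neutral_right) (use fin NP in \<open>auto simp: L_def\<close>)
    also have "\<dots> = (\<Sum>p\<in>N. \<Sum>l<m. y l * (c l p * coeff (charcof B p) i))"
      by (intro sum.cong refl) (simp add: L_def d_def sum_distrib_right mult.assoc)
    also have "\<dots> = (\<Sum>l<m. y l * (\<Sum>p\<in>N. c l p * coeff (charcof B p) i))"
      by (subst sum.swap) (simp add: sum_distrib_left)
    also have "\<dots> = (\<Sum>l<m. y l * coeff (monom 1 l) i)"
      by (intro sum.cong refl) (simp add: c coeff_sum)
    also have "\<dots> = (\<Sum>l<m. if l = i then y l else 0)"
      by (intro sum.cong) auto
    also have "\<dots> = y i" using i by simp
    finally show ?thesis .
  qed
  have aff: "f i (Z(p := t)) = f i Z + (t - Z p) * g i p Z" if p: "p \<in> P" for i Z p t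
  proof -
    obtain u v where uv: "p = (u, v)" "u < m" "v < m" using p by (auto simp: P_def)
    have "char_poly (Matrix.mat m m (Z(p := t))) = char_poly (Matrix.mat m m Z)
      - Polynomial.smult (Matrix.mat m m (Z(p := t)) $$ (u, v) - Matrix.mat m m Z $$ (u, v))
          (charcof (Matrix.mat m m Z) (u, v))"
      by (rule char_poly_perturb[of _ m]) (use uv in auto)
    then show ?thesis
      using uv by (simp add: f_def g_def)
  qed
  \<comment> \<open>\<open>L\<close> is Lipschitz with constant \<open>K\<close> in each of the \<open>m ^ 2\<close> entries, so slopes within this \<open>\<kappa>\<close> of
    those at \<open>B\<close> produce an error with Lipschitz constant \<open>1/2\<close>.\<close>
  define \<kappa> where "\<kappa> = 1 / (2 * K * (real m)\<^sup>2)"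
  have \<kappa>: "\<kappa> > 0" using K m by (simp add: \<kappa>_def)
  obtain \<rho> where \<rho>: "\<rho> > 0" and near: "\<And>G p i. \<lbrakk>\<And>q. q \<in> P \<Longrightarrow> \<bar>G q - B $$ q\<bar> \<le> \<rho>; p \<in> P; i < m\<rbrakk> \<Longrightarrow>
      \<bar>g i p G - d i p\<bar> \<le> \<kappa>"
  proof (rule charcof_near[OF B \<kappa>, folded P_def])
    fix \<rho> :: real
    assume \<rho>: "\<rho> > 0" and near: "\<And>G p i. \<lbrakk>\<And>q. q \<in> P \<Longrightarrow> \<bar>G q - B $$ q\<bar> \<le> \<rho>; p \<in> P; i < m\<rbrakk> \<Longrightarrow>
      \<bar>coeff (charcof (Matrix.mat m m G) p) i - coeff (charcof B p) i\<bar> \<le> \<kappa>"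
    show thesis
    proof (rule that[OF \<rho>])
      fix G p i
      assume "\<And>q. q \<in> P \<Longrightarrow> \<bar>G q - B $$ q\<bar> \<le> \<rho>" "p \<in> P" "i < m"
      from near[OF this] show "\<bar>g i p G - d i p\<bar> \<le> \<kappa>"
        unfolding g_def d_def by linarith
    qed
  qed
  have incr: "\<bar>f i G' - f i G - (\<Sum>p\<in>P. (G' p - G p) * d i p)\<bar> \<le> \<kappa> * (\<Sum>p\<in>P. \<bar>G' p - G p\<bar>)"
    if G: "\<And>q. q \<in> P \<Longrightarrow> \<bar>G q - B $$ q\<bar> \<le> \<rho>" and G': "\<And>q. q \<in> P \<Longrightarrow> \<bar>G' q - B $$ q\<bar> \<le> \<rho>"
      and off: "\<And>q. q \<notin> P \<Longrightarrow> G' q = G q" and i: "i < m" for G G' i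
  proof (rule multiaffine_increment[where g = "g i"])
    fix p Z assume p: "p \<in> P" and Z: "\<And>q. Z q \<in> {G q, G' q}"
    show "\<bar>g i p Z - d i p\<bar> \<le> \<kappa>"
    proof (rule near[OF _ p i])
      show "\<bar>Z q - B $$ q\<bar> \<le> \<rho>" if "q \<in> P" for q
        using Z[of q] G[OF that] G'[OF that] by auto
    qed
  qed (fact fin(1), rule aff, assumption, rule off, assumption)
  \<comment> \<open>The bound \<open>\<beta>\<close> protects the signs of the nonzero entries of \<open>B\<close>; inserting \<open>1\<close> makes the minimum
    meaningful for an empty set.\<close>
  define \<beta> where "\<beta> = Min (insert 1 ((\<lambda>p. \<bar>B $$ p\<bar>) ` N))"
  have \<beta>: "\<beta> > 0" "\<And>p. p \<in> N \<Longrightarrow> \<beta> \<le> \<bar>B $$ p\<bar>"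
    using fin by (auto simp: \<beta>_def N_def)
  \<comment> \<open>The half of \<open>\<rho>\<close> that \<open>r\<close> leaves unused is the room for \<open>\<epsilon> E\<close>.\<close>
  define r where "r = min (\<rho> / 2) (\<beta> / 2) / K"
  have r: "r > 0" "K * r \<le> \<rho> / 2" "K * r < \<beta>"
    using \<rho> \<beta>(1) K by (auto simp: r_def)
  define C where "C = 1 + (\<Sum>i<m. \<Sum>p\<in>P. \<bar>d i p\<bar> + \<kappa>)"
  have C: "C > 0" unfolding C_def using \<kappa> by (intro add_pos_nonneg sum_nonneg) auto
  \<comment> \<open>\<open>C\<close> bounds the displacement of each coefficient per unit of \<open>\<epsilon>\<close>, so \<open>E\<close> shifts the coefficients by
    at most \<open>r / 4\<close>.\<close>
  define \<epsilon> where "\<epsilon> = min (\<rho> / 2) (r / 4 / C)"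
  have \<epsilon>: "\<epsilon> > 0" "\<epsilon> \<le> \<rho> / 2" "\<epsilon> * C \<le> r / 4"
  proof -
    have "\<epsilon> \<le> r / 4 / C" by (simp add: \<epsilon>_def)
    then show "\<epsilon> * C \<le> r / 4" using C by (simp add: pos_le_divide_eq)
  qed (use \<rho> r C in \<open>auto simp: \<epsilon>_def\<close>)
  define H where "H y i = f i (X \<epsilon> y)" for y i
  have \<epsilon>E: "\<bar>\<epsilon> * E p\<bar> \<le> \<epsilon>" for p
    using \<epsilon>(1) E1[of p] mult_left_mono[OF E1[of p], of \<epsilon>] by (simp add: abs_mult)
  have X_near: "\<bar>X \<epsilon> y q - B $$ q\<bar> \<le> \<rho>" if "\<And>i. i < m \<Longrightarrow> \<bar>y i\<bar> \<le> r" for y q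
    using L_le[of y r q, OF that] r(2) \<epsilon>E[of q] \<epsilon>(2) unfolding X_def by linarith
  have L0: "L (\<lambda>_. 0) p = 0" for p by (simp add: L_def)
  have H0: "\<bar>H (\<lambda>_. 0) i\<bar> \<le> r / 4" if i: "i < m" for i
  proof -
    let ?X = "X \<epsilon> (\<lambda>_. 0)"
    \<comment> \<open>\<open>G\<close> represents \<open>B\<close>, but agrees with \<open>?X\<close> at the indices outside the matrix, where an entry of \<open>B\<close>
      is an unspecified value.\<close>
    define G where "G q = (if q \<in> P then B $$ q else ?X q)" for q
    have step: "\<bar>f i ?X - f i G - (\<Sum>p\<in>P. (?X p - G p) * d i p)\<bar> \<le> \<kappa> * (\<Sum>p\<in>P. \<bar>?X p - G p\<bar>)"
      by (rule incr[OF _ _ _ i]) (use X_near[of "\<lambda>_. 0"] r \<rho> in \<open>auto simp: G_def\<close>)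
    have "Matrix.mat m m G = B"
      using B by (intro eq_matI) (auto simp: G_def P_def)
    then have fG: "f i G = 0" using i by (simp add: f_def chi)
    have s1: "(\<Sum>p\<in>P. (?X p - G p) * d i p) = (\<Sum>p\<in>P. \<epsilon> * E p * d i p)"
      by (intro sum.cong refl) (simp add: G_def X_def L0)
    have s2: "(\<Sum>p\<in>P. \<bar>?X p - G p\<bar>) = (\<Sum>p\<in>P. \<bar>\<epsilon> * E p\<bar>)"
      by (intro sum.cong refl) (simp add: G_def X_def L0)
    have "\<bar>H (\<lambda>_. 0) i\<bar> \<le> \<bar>\<Sum>p\<in>P. \<epsilon> * E p * d i p\<bar> + \<kappa> * (\<Sum>p\<in>P. \<bar>\<epsilon> * E p\<bar>)"
      using step unfolding H_def fG s1 s2 by linarith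
    also have "\<dots> \<le> (\<Sum>p\<in>P. \<bar>\<epsilon> * E p * d i p\<bar>) + \<kappa> * (\<Sum>p\<in>P. \<bar>\<epsilon> * E p\<bar>)"
      by (intro add_right_mono sum_abs)
    also have "\<dots> = (\<Sum>p\<in>P. \<bar>\<epsilon> * E p\<bar> * (\<bar>d i p\<bar> + \<kappa>))"
      by (simp add: abs_mult sum_distrib_left sum.distrib distrib_left mult_ac)
    also have "\<dots> \<le> (\<Sum>p\<in>P. \<epsilon> * (\<bar>d i p\<bar> + \<kappa>))"
      by (intro sum_mono mult_right_mono \<epsilon>E) (use \<kappa> in auto)
    also have "\<dots> = \<epsilon> * (\<Sum>p\<in>P. \<bar>d i p\<bar> + \<kappa>)" by (rule sum_distrib_left[symmetric])
    also have "\<dots> \<le> \<epsilon> * C"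
    proof (rule mult_left_mono)
      have "(\<Sum>p\<in>P. \<bar>d i p\<bar> + \<kappa>) \<le> (\<Sum>i<m. \<Sum>p\<in>P. \<bar>d i p\<bar> + \<kappa>)"
        by (rule member_le_sum[where f = "\<lambda>i. \<Sum>p\<in>P. \<bar>d i p\<bar> + \<kappa>"])
          (use i \<kappa> in \<open>auto intro!: sum_nonneg\<close>)
      then show "(\<Sum>p\<in>P. \<bar>d i p\<bar> + \<kappa>) \<le> C" by (simp add: C_def)
    qed (use \<epsilon> in simp)
    finally show ?thesis using \<epsilon>(3) by linarith
  qed
  have surj: "\<exists>y. (\<forall>i<m. \<bar>y i\<bar> \<le> r) \<and> (\<forall>i<m. H y i = q i)"
    if q: "\<And>i. i < m \<Longrightarrow> \<bar>q i\<bar> \<le> r / 4" for q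
  proof (rule near_identity_surj[OF r(1)])
    show "\<bar>q i - H (\<lambda>_. 0) i\<bar> \<le> r / 2" if "i < m" for i
      using q[OF that] H0[OF that] by linarith
  next
    fix y y' :: "nat \<Rightarrow> real" and e :: real and i
    assume y: "\<And>i. i < m \<Longrightarrow> \<bar>y i\<bar> \<le> r" and y': "\<And>i. i < m \<Longrightarrow> \<bar>y' i\<bar> \<le> r"
      and e: "\<And>i. i < m \<Longrightarrow> \<bar>y i - y' i\<bar> \<le> e" and i: "i < m"
    let ?z = "\<lambda>i. y i - y' i"
    have df: "X \<epsilon> y p - X \<epsilon> y' p = L ?z p" for p
      by (simp add: X_def L_diff[symmetric])
    have "\<bar>f i (X \<epsilon> y) - f i (X \<epsilon> y') - (\<Sum>p\<in>P. (X \<epsilon> y p - X \<epsilon> y' p) * d i p)\<bar>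
        \<le> \<kappa> * (\<Sum>p\<in>P. \<bar>X \<epsilon> y p - X \<epsilon> y' p\<bar>)"
      by (rule incr[OF X_near[of y', OF y'] X_near[of y, OF y] _ i]) (use NP in \<open>auto simp: X_def L_def\<close>)
    then have "\<bar>(H y i - y i) - (H y' i - y' i)\<bar> \<le> \<kappa> * (\<Sum>p\<in>P. \<bar>L ?z p\<bar>)"
      unfolding df deriv_L[OF i] H_def by (simp add: algebra_simps)
    also have "\<dots> \<le> \<kappa> * (\<Sum>p\<in>P. K * e)"
      by (intro mult_left_mono sum_mono L_le[of ?z e, OF e]) (use \<kappa> in auto)
    also have "\<dots> = e / 2"
      using K m by (simp add: \<kappa>_def P_def power2_eq_square)
    finally show "\<bar>(H y i - y i) - (H y' i - y' i)\<bar> \<le> e / 2" .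
  qed
  have dimS: "\<S> \<in> carrier_mat m m"
    using sup B by (auto simp: superpattern_def sgn_mat_def)
  have S_N: "\<S> $$ p = sgn_of (B $$ p)" if "p \<in> N" for p
    using sup B that by (auto simp: superpattern_def sgn_mat_def N_def P_def sgn_of_def split: if_splits)
  have sign: "sgn_of (X \<epsilon> y p) = \<S> $$ p" if y: "\<And>i. i < m \<Longrightarrow> \<bar>y i\<bar> \<le> r" and p: "p \<in> P" for y p
  proof (cases "p \<in> N")
    case True
    then have "X \<epsilon> y p = B $$ p + L y p" by (simp add: X_def E_def)
    moreover have "\<bar>L y p\<bar> < \<bar>B $$ p\<bar>"
      using L_le[of y r p, OF y] \<beta>(2)[OF True] r(3) by linarith
    ultimately have "sgn_of (X \<epsilon> y p) = sgn_of (B $$ p)"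
      by (auto simp: sgn_of_def)
    then show ?thesis using S_N[OF True] by simp
  next
    case False
    then show ?thesis
      using p \<epsilon>(1) by (auto simp: X_def L_def E_def N_def sgn_of_def split: sgn_entry.splits)
  qed
  show ?thesis
    unfolding spectrally_arbitrary_def sign_pattern_def
  proof (intro conjI allI impI dimS)
    fix p :: "real poly" assume p: "degree p = m \<and> lead_coeff p = 1"
    define S where "S = 1 + (\<Sum>i<m. \<bar>coeff p i\<bar>)"
    have S: "S > 0" unfolding S_def by (intro add_pos_nonneg sum_nonneg) auto
    \<comment> \<open>\<open>t\<close> is so small that the lower coefficients of \<open>t ^ m * p (z / t)\<close> lie in the reachable neighbourhood.\<close>
    define t where "t = min 1 (r / 4 / S)"
    have t: "t > 0" "t \<le> 1" "t * S \<le> r / 4"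
    proof -
      have "t \<le> r / 4 / S" by (simp add: t_def)
      then show "t * S \<le> r / 4" using S by (simp add: pos_le_divide_eq)
    qed (use r S in \<open>auto simp: t_def\<close>)
    have "\<bar>t ^ (m - i) * coeff p i\<bar> \<le> r / 4" if i: "i < m" for i
    proof -
      have "t ^ (m - i) \<le> t ^ 1"
        using i t by (intro power_decreasing) auto
      moreover have "\<bar>coeff p i\<bar> \<le> S"
        using member_le_sum[of i "{..<m}" "\<lambda>i. \<bar>coeff p i\<bar>"] i by (simp add: S_def)
      ultimately have "t ^ (m - i) * \<bar>coeff p i\<bar> \<le> t * S"
        using t by (intro mult_mono) auto
      then show ?thesis using t by (simp add: abs_mult)
    qed
    from surj[of "\<lambda>i. t ^ (m - i) * coeff p i", OF this] obtain y where y: "\<And>i. i < m \<Longrightarrow> \<bar>y i\<bar> \<le> r"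
      and Hy: "\<And>i. i < m \<Longrightarrow> H y i = t ^ (m - i) * coeff p i"
      by blast
    define M where "M = Matrix.mat m m (X \<epsilon> y)"
    have M: "M \<in> carrier_mat m m" by (simp add: M_def)
    have tM: "(1 / t) \<cdot>\<^sub>m M \<in> carrier_mat m m" using M by simp
    have "sgn_mat ((1 / t) \<cdot>\<^sub>m M) = \<S>"
    proof (rule eq_matI)
      fix u v assume "u < dim_row \<S>" "v < dim_col \<S>"
      then have uv: "u < m" "v < m" using dimS by auto
      then have "sgn_mat ((1 / t) \<cdot>\<^sub>m M) $$ (u, v) = sgn_of (X \<epsilon> y (u, v) / t)"
        by (simp add: sgn_mat_def M_def)
      also have "\<dots> = sgn_of (X \<epsilon> y (u, v))"
        using t(1) by (auto simp: sgn_of_def zero_less_divide_iff)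
      also have "\<dots> = \<S> $$ (u, v)"
        by (rule sign) (use y uv in \<open>auto simp: P_def\<close>)
      finally show "sgn_mat ((1 / t) \<cdot>\<^sub>m M) $$ (u, v) = \<S> $$ (u, v)" .
    qed (use dimS M in \<open>auto simp: sgn_mat_def\<close>)
    moreover have "char_poly ((1 / t) \<cdot>\<^sub>m M) = p"
    proof (rule poly_eqI)
      fix i
      consider "i < m" | "i = m" | "i > m" by linarith
      then show "coeff (char_poly ((1 / t) \<cdot>\<^sub>m M)) i = coeff p i"
      proof cases
        case 1
        then have "coeff (char_poly M) i = t ^ (m - i) * coeff p i"
          using Hy[OF 1] by (simp add: H_def f_def M_def)
        then show ?thesis
          using coeff_char_poly_smult[OF M, of "1 / t" i] 1 t(1) by (simp add: power_divide)
      next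
        case 2
        then show ?thesis using degree_monic_char_poly[OF tM] p by auto
      next
        case 3
        then show ?thesis using degree_monic_char_poly[OF tM] p by (simp add: coeff_eq_0)
      qed
    qed
    ultimately show "\<exists>A\<in>qual_class \<S>. char_poly A = p"
      using qual_class_iff_sgn_mat by blast
  qed
qed

section \<open>The bordered matrix\<close>

text \<open>
  Deleting the last row leaves \<open>- e\<^sub>j\<close> as last column. Expanding along it deletes row \<open>j\<close> as well,
  and the two signs combine to the sign of position \<open>(j, v)\<close>.
\<close>

lemma charcof_bordered_last_row:
  fixes M :: "'a::comm_ring_1 Matrix.mat"
  assumes M: "M \<in> carrier_mat n n" and j: "j < n" and v: "v < n"
    and D: "D \<in> carrier_mat (Suc n) (Suc n)"
    and block: "\<And>i c. i < n \<Longrightarrow> c < n \<Longrightarrow> D $$ (i, c) = M $$ (i, c)"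
    and col: "\<And>i. i < n \<Longrightarrow> D $$ (i, n) = (if i = j then 1 else 0)"
  shows "charcof D (n, v) = charcof M (j, v)"
proof -
  let ?D = "char_poly_matrix D" and ?M = "char_poly_matrix M"
  obtain n' where n: "n = Suc n'" using j by (cases n) auto
  have cD: "?D \<in> carrier_mat (Suc n) (Suc n)" and cM: "?M \<in> carrier_mat n n" using D M by auto
  let ?X = "mat_delete ?D n v"
  have X: "?X \<in> carrier_mat n n" using mat_delete_carrier[OF cD] by simp
  have Xc: "?X $$ (i, n') = (if i = j then - 1 else 0)" if "i < n" for i
  proof -
    have "?X $$ (i, n') = ?D $$ (i, n)"
      using that v n carrier_matD[OF cD] by (simp add: mat_delete_def)
    also have "\<dots> = (if i = j then - 1 else 0)"
      using that char_poly_matrix_index[OF D, of i n] col[OF that] by (simp add: one_pCons)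
    finally show ?thesis .
  qed
  have "Determinant.det ?X = (\<Sum>i<n. ?X $$ (i, n') * cofactor ?X i n')"
    by (rule laplace_expansion_column[OF X]) (simp add: n)
  also have "\<dots> = (\<Sum>i<n. if i = j then - cofactor ?X i n' else 0)"
    by (intro sum.cong refl) (auto simp: Xc)
  also have "\<dots> = - cofactor ?X j n'" using j by simp
  finally have det: "Determinant.det ?X = - cofactor ?X j n'" .
  have "mat_delete ?X j n' = mat_delete ?M j v"
    using carrier_matD[OF cD] carrier_matD[OF cM] j v n
    by (auto intro!: eq_matI simp: mat_delete_def char_poly_matrix_index[OF D]
        char_poly_matrix_index[OF M] block)
  then have X_cof: "cofactor ?X j n' = (-1) ^ (j + n') * Determinant.det (mat_delete ?M j v)"
    by (simp add: cofactor_def)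
  have "(-1) ^ (n + v) * (-1) ^ (j + n') = (-1 :: 'a poly) ^ (2 * n' + Suc (j + v))"
    unfolding power_add[symmetric] by (simp add: n mult_2 mult_2_right ac_simps)
  also have "\<dots> = - ((-1) ^ (j + v))"
    by (simp add: power_add power_mult)
  finally have sign: "(-1) ^ (n + v) * (-1) ^ (j + n') = - ((-1 :: 'a poly) ^ (j + v))" .
  have "charcof D (n, v) = - ((-1) ^ (n + v) * (-1) ^ (j + n') * Determinant.det (mat_delete ?M j v))"
    unfolding charcof_def fst_conv snd_conv cofactor_def[of ?D] det X_cof by (simp add: mult.assoc)
  then show ?thesis
    unfolding sign by (simp add: charcof_def cofactor_def)
qed

text \<open>
  Laplace expansion along the last row.
\<close>

lemma char_poly_bordered:
  fixes M :: "'a::comm_ring_1 Matrix.mat"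
  assumes M: "M \<in> carrier_mat n n" and j: "j < n"
    and D: "D \<in> carrier_mat (Suc n) (Suc n)"
    and block: "\<And>i c. i < n \<Longrightarrow> c < n \<Longrightarrow> D $$ (i, c) = M $$ (i, c)"
    and col: "\<And>i. i < n \<Longrightarrow> D $$ (i, n) = (if i = j then 1 else 0)"
    and corner: "D $$ (n, n) = 0"
  shows "char_poly D = [:0, 1:] * char_poly M - (\<Sum>v<n. [:D $$ (n, v):] * charcof M (j, v))"
proof -
  let ?D = "char_poly_matrix D" and ?M = "char_poly_matrix M"
  have cD: "?D \<in> carrier_mat (Suc n) (Suc n)" and cM: "?M \<in> carrier_mat n n" using D M by auto
  have "mat_delete ?D n n = ?M"
    using carrier_matD[OF cD] carrier_matD[OF cM]
    by (auto intro!: eq_matI simp: mat_delete_def char_poly_matrix_index[OF D]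
        char_poly_matrix_index[OF M] block)
  then have nn: "charcof D (n, n) = char_poly M"
    by (simp add: charcof_def cofactor_def char_poly_def)
  have "char_poly D = (\<Sum>v<n. ?D $$ (n, v) * charcof D (n, v)) + ?D $$ (n, n) * charcof D (n, n)"
    by (subst char_poly_row[OF D, of n]) simp_all
  also have "(\<Sum>v<n. ?D $$ (n, v) * charcof D (n, v)) = (\<Sum>v<n. - ([:D $$ (n, v):] * charcof M (j, v)))"
    by (intro sum.cong refl)
      (simp add: char_poly_matrix_index[OF D] charcof_bordered_last_row[OF M j _ D block col])
  also have "?D $$ (n, n) = [:0, 1:]"
    by (simp add: char_poly_matrix_index[OF D] corner)
  finally show ?thesis
    by (simp add: nn sum_negf)
qed

text \<open>
  Subtracting \<open>b\<close> at \<open>(j, k)\<close> is compensated by a last row equal to \<open>b\<close> times row \<open>k\<close>: the former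
  adds \<open>b z\<close> times the cofactor at \<open>(j, k)\<close>, and by \<open>charcof_alien_row\<close> the latter subtracts the
  same. Only the deviation of the last row from \<open>b\<close> times row \<open>k\<close> of \<open>A\<close> remains. The matrix \<open>D\<close>
  is described by its entries so that the formula also applies after single entries are changed.
\<close>

lemma char_poly_bordered_shift:
  fixes A :: "'a::comm_ring_1 Matrix.mat"
  assumes A: "A \<in> carrier_mat n n" and jk: "j < n" "k < n" "j \<noteq> k"
    and D: "D \<in> carrier_mat (Suc n) (Suc n)"
    and block: "\<And>i c. i < n \<Longrightarrow> c < n \<Longrightarrow> D $$ (i, c) = A $$ (i, c) - (if (i, c) = (j, k) then b else 0)"
    and col: "\<And>i. i < n \<Longrightarrow> D $$ (i, n) = (if i = j then 1 else 0)"
    and corner: "D $$ (n, n) = 0"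
  shows "char_poly D = [:0, 1:] * char_poly A
    - (\<Sum>v<n. [:D $$ (n, v) - b * A $$ (k, v):] * charcof A (j, v))"
proof -
  define M where "M = Matrix.mat n n (\<lambda>(i, c). A $$ (i, c) - (if (i, c) = (j, k) then b else 0))"
  have M: "M \<in> carrier_mat n n" by (simp add: M_def)
  have cof: "charcof M (j, v) = charcof A (j, v)" if "v < n" for v
    by (rule charcof_cong[OF A M jk(1) that]) (auto simp: M_def)
  have "char_poly M = char_poly A - Polynomial.smult (M $$ (j, k) - A $$ (j, k)) (charcof A (j, k))"
    by (rule char_poly_perturb[OF A M jk(1,2)]) (auto simp: M_def)
  then have "[:0, 1:] * char_poly M = [:0, 1:] * char_poly A + [:b:] * ([:0, 1:] * charcof A (j, k))"
    using jk by (simp add: M_def algebra_simps)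
  also have "[:0, 1:] * charcof A (j, k) = (\<Sum>v<n. [:A $$ (k, v):] * charcof A (j, v))"
    using charcof_alien_row[OF A jk] by simp
  finally have zM: "[:0, 1:] * char_poly M
      = [:0, 1:] * char_poly A + (\<Sum>v<n. [:b * A $$ (k, v):] * charcof A (j, v))"
    by (simp add: sum_distrib_left smult_sum2 mult.commute[of b])
  have "char_poly D = [:0, 1:] * char_poly M - (\<Sum>v<n. [:D $$ (n, v):] * charcof M (j, v))"
    by (rule char_poly_bordered[OF M jk(1) D _ col corner]) (simp_all add: block M_def)
  also have "(\<Sum>v<n. [:D $$ (n, v):] * charcof M (j, v)) = (\<Sum>v<n. [:D $$ (n, v):] * charcof A (j, v))"
    by (intro sum.cong refl) (simp add: cof)
  finally show ?thesis
    unfolding zM by (simp add: sum_subtractf smult_diff_left)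
qed

lemma bordered_mat_carrier:
  assumes "A \<in> carrier_mat n n"
  shows "bordered_mat n A j k b \<in> carrier_mat (Suc n) (Suc n)"
  using assms by (auto simp: bordered_mat_def Let_def unit_entry_mat_def)

lemma bordered_mat_index:
  assumes "A \<in> carrier_mat n n" "j < n" "k < n" "j \<noteq> k"
  shows "\<And>i c. i < n \<Longrightarrow> c < n \<Longrightarrow>
      bordered_mat n A j k b $$ (i, c) = A $$ (i, c) - (if (i, c) = (j, k) then b else 0)"
    and "\<And>i. i < n \<Longrightarrow> bordered_mat n A j k b $$ (i, n) = (if i = j then 1 else 0)"
    and "\<And>c. c < n \<Longrightarrow> bordered_mat n A j k b $$ (n, c) = b * A $$ (k, c)"
    and "bordered_mat n A j k b $$ (n, n) = 0"
  using assms
  by (auto simp: bordered_mat_def Let_def unit_entry_mat_def mat_of_cols_index mat_of_rows_index)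

text \<open>
  Cofactors are negated increments of the characteristic polynomial when one entry is raised by
  \<open>1\<close>, so they follow from \<open>char_poly_bordered_shift\<close> for the matrices with that entry raised. A
  change in row \<open>k\<close> of the old block is not copied into the last row, which makes the last row
  deviate there; this is the source of the additional term for \<open>u = k\<close>.
\<close>

lemma charcof_bordered:
  fixes A :: "real Matrix.mat" and b :: real
  assumes A: "A \<in> carrier_mat n n" and jk: "j < n" "k < n" "j \<noteq> k" and v: "v < n"
  defines "B \<equiv> bordered_mat n A j k b"
  shows charcof_bordered_block: "u < n \<Longrightarrow>
      charcof B (u, v) = [:0, 1:] * charcof A (u, v) - (if u = k then Polynomial.smult b (charcof A (j, v)) else 0)"
    and charcof_bordered_last: "charcof B (n, v) = charcof A (j, v)"
proof -
  note idx = bordered_mat_index[OF A jk, where b = b, folded B_def]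
  have B: "B \<in> carrier_mat (Suc n) (Suc n)"
    unfolding B_def by (rule bordered_mat_carrier[OF A])
  have chiB: "char_poly B = [:0, 1:] * char_poly A"
    by (subst char_poly_bordered_shift[OF A jk B idx(1,2,4)]) (simp_all add: idx)
  define bump where "bump u m X = Matrix.mat m m (\<lambda>p. X $$ p + (if p = (u, v) then 1 else 0))"
    for u m and X :: "real Matrix.mat"
  have chi: "char_poly (bump u m X) = char_poly X - charcof X (u, v)"
    if "X \<in> carrier_mat m m" "u < m" "v < m" for u m X
    using char_poly_perturb[OF that(1) _ that(2,3), of "bump u m X"] that by (simp add: bump_def)
  show "charcof B (n, v) = charcof A (j, v)"
  proof -
    have "char_poly (bump n (Suc n) B) = [:0, 1:] * char_poly A
      - (\<Sum>c<n. [:bump n (Suc n) B $$ (n, c) - b * A $$ (k, c):] * charcof A (j, c))"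
      by (rule char_poly_bordered_shift[OF A jk]) (use v in \<open>auto simp: bump_def idx\<close>)
    also have "(\<Sum>c<n. [:bump n (Suc n) B $$ (n, c) - b * A $$ (k, c):] * charcof A (j, c))
        = (\<Sum>c<n. if c = v then charcof A (j, c) else 0)"
      by (intro sum.cong refl) (auto simp: bump_def idx)
    finally show ?thesis using chi[OF B, of n] chiB v by simp
  qed
  assume u: "u < n"
  let ?A = "bump u n A" and ?B = "bump u (Suc n) B"
  have A': "?A \<in> carrier_mat n n" by (simp add: bump_def)
  have "char_poly ?B = [:0, 1:] * char_poly ?A - (\<Sum>c<n. [:?B $$ (n, c) - b * ?A $$ (k, c):] * charcof ?A (j, c))"
    by (rule char_poly_bordered_shift[OF A' jk]) (use u v jk in \<open>auto simp: bump_def idx\<close>)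
  also have "(\<Sum>c<n. [:?B $$ (n, c) - b * ?A $$ (k, c):] * charcof ?A (j, c))
      = (\<Sum>c<n. if c = v then (if u = k then - Polynomial.smult b (charcof ?A (j, c)) else 0) else 0)"
    by (intro sum.cong refl) (use u jk in \<open>auto simp: bump_def idx algebra_simps\<close>)
  also have "\<dots> = (if u = k then - Polynomial.smult b (charcof ?A (j, v)) else 0)"
    using v by simp
  also have "charcof ?A (j, v) = charcof A (j, v)"
    by (rule charcof_cong[OF A A' jk(1) v]) (auto simp: bump_def)
  finally have chi': "char_poly ?B = [:0, 1:] * char_poly ?A
    - (if u = k then - Polynomial.smult b (charcof A (j, v)) else 0)" .
  have "charcof B (u, v) = char_poly B - char_poly ?B"
    using chi[OF B less_SucI[OF u] less_SucI[OF v]] by simp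
  also have "\<dots> = [:0, 1:] * char_poly A - ([:0, 1:] * (char_poly A - charcof A (u, v))
    - (if u = k then - Polynomial.smult b (charcof A (j, v)) else 0))"
    unfolding chi' chiB chi[OF A u v] ..
  finally show "charcof B (u, v) = [:0, 1:] * charcof A (u, v)
      - (if u = k then Polynomial.smult b (charcof A (j, v)) else 0)"
    by (simp add: right_diff_distrib del: mult_pCons_left)
qed

text \<open>
  With \<open>W = b e\<^sub>k\<^sup>T\<close> and \<open>T W\<close> the block matrix with rows \<open>(I, 0)\<close> and \<open>(W, 1)\<close>, the bordered matrix
  is \<open>T W * N * T (- W)\<close> for the block triangular \<open>N\<close> with rows \<open>(A, e\<^sub>j)\<close> and \<open>(0, 0)\<close>. The
  assumption \<open>j \<noteq> k\<close> enters as \<open>W e\<^sub>j = 0\<close>, which makes the corner vanish.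
\<close>

lemma nilpotent_bordered:
  assumes nil: "nilpotent_mat n A" and jk: "j < n" "k < n" "j \<noteq> k"
  shows "nilpotent_mat (Suc n) (bordered_mat n A j k b)"
proof -
  obtain r where A: "A \<in> carrier_mat n n" and r: "A ^\<^sub>m r = 0\<^sub>m n n"
    using nil by (auto simp: nilpotent_mat_def)
  define B where "B = bordered_mat n A j k b"
  note idx = bordered_mat_index[OF A jk, where b = b, folded B_def]
  have B: "B \<in> carrier_mat (Suc n) (Suc n)"
    unfolding B_def by (rule bordered_mat_carrier[OF A])
  define W where "W = Matrix.mat 1 n (\<lambda>(i, c). if c = k then b else 0)"
  define E where "E = Matrix.mat n 1 (\<lambda>(i, c). if i = j then 1 else (0::real))"
  have W: "W \<in> carrier_mat 1 n" and E: "E \<in> carrier_mat n 1" by (auto simp: W_def E_def)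
  define N where "N = four_block_mat A E (0\<^sub>m 1 n) (0\<^sub>m 1 1)"
  define T where "T X = four_block_mat (1\<^sub>m n) (0\<^sub>m n 1) X (1\<^sub>m 1)" for X :: "real Matrix.mat"
  have one: "four_block_mat (1\<^sub>m n) (0\<^sub>m n 1) (0\<^sub>m 1 n) (1\<^sub>m 1) = (1\<^sub>m (Suc n) :: real Matrix.mat)"
    by (intro eq_matI) auto
  have TT: "T X * T Y = 1\<^sub>m (Suc n)" if "X \<in> carrier_mat 1 n" "Y \<in> carrier_mat 1 n" "X + Y = 0\<^sub>m 1 n" for X Y
    unfolding T_def using that
    by (subst mult_four_block_mat[where ?nr1.0 = n and ?n1.0 = n and ?n2.0 = 1 and ?nr2.0 = 1 and ?nc1.0 = n and ?nc2.0 = 1])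
      (auto simp: one)
  have WA: "W * A = Matrix.mat 1 n (\<lambda>(i, c). b * A $$ (k, c))"
  proof (rule eq_matI)
    fix i c assume "i < dim_row (Matrix.mat 1 n (\<lambda>(i, c). b * A $$ (k, c)))"
      "c < dim_col (Matrix.mat 1 n (\<lambda>(i, c). b * A $$ (k, c)))"
    then have ic: "i = 0" "c < n" by auto
    have "(W * A) $$ (i, c) = (\<Sum>l<n. (if l = k then b else 0) * A $$ (l, c))"
      using A ic by (simp add: W_def scalar_prod_def lessThan_atLeast0)
    also have "\<dots> = (\<Sum>l<n. if l = k then b * A $$ (l, c) else 0)"
      by (intro sum.cong refl) simp
    finally show "(W * A) $$ (i, c) = Matrix.mat 1 n (\<lambda>(i, c). b * A $$ (k, c)) $$ (i, c)"
      using jk ic by simp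
  qed (use A W in auto)
  have WE: "W * E = 0\<^sub>m 1 1"
    using jk by (intro eq_matI) (auto simp: W_def E_def scalar_prod_def intro!: sum.neutral)
  have EW: "E * W = Matrix.mat n n (\<lambda>(i, c). if (i, c) = (j, k) then b else 0)"
    by (intro eq_matI) (auto simp: W_def E_def scalar_prod_def)
  have TN: "T W * N = four_block_mat A E (W * A) (0\<^sub>m 1 1)"
    unfolding T_def N_def using A W E WE
    by (subst mult_four_block_mat[where ?nr1.0 = n and ?n1.0 = n and ?n2.0 = 1 and ?nr2.0 = 1 and ?nc1.0 = n and ?nc2.0 = 1])
      auto
  have "T W * N * T (- W) = four_block_mat (A + E * (- W)) E (W * A) (0\<^sub>m 1 1)"
    unfolding TN unfolding T_def using A W E
    by (subst mult_four_block_mat[where ?nr1.0 = n and ?n1.0 = n and ?n2.0 = 1 and ?nr2.0 = 1 and ?nc1.0 = n and ?nc2.0 = 1])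
      auto
  also have "E * (- W) = - (E * W)" using E W by auto
  also have "four_block_mat (A + - (E * W)) E (W * A) (0\<^sub>m 1 1) = B"
  proof (rule eq_matI)
    fix i c assume "i < dim_row B" "c < dim_col B"
    then have "i < n \<or> i = n" "c < n \<or> c = n" using B by auto
    then show "four_block_mat (A + - (E * W)) E (W * A) (0\<^sub>m 1 1) $$ (i, c) = B $$ (i, c)"
      unfolding EW WA using A E by (auto simp: idx) (auto simp: E_def)
  qed (use A B E W in auto)
  finally have BTN: "B = T W * N * T (- W)" by simp
  have carr: "N \<in> carrier_mat (Suc n) (Suc n)" "T X \<in> carrier_mat (Suc n) (Suc n)"
    if "X \<in> carrier_mat 1 n" for X
    using A W E that by (auto simp: N_def T_def)
  have "similar_mat_wit B N (T W) (T (- W))"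
    by (rule similar_mat_witI[where n = "Suc n"]) (use B W carr BTN in \<open>auto intro!: TT\<close>)
  then have pow: "B ^\<^sub>m s = T W * N ^\<^sub>m s * T (- W)" for s
    by (rule similar_mat_wit_pow_id)
  have "N ^\<^sub>m Suc s = four_block_mat (A ^\<^sub>m Suc s) (A ^\<^sub>m s * E) (0\<^sub>m 1 n) (0\<^sub>m 1 1)" for s
  proof (induction s)
    case 0
    then show ?case using A E by (simp add: N_def)
  next
    case (Suc s)
    have "N ^\<^sub>m Suc (Suc s) = N ^\<^sub>m Suc s * N" by simp
    also have "\<dots> = four_block_mat (A ^\<^sub>m Suc s) (A ^\<^sub>m s * E) (0\<^sub>m 1 n) (0\<^sub>m 1 1) * N"
      unfolding Suc ..
    also have "\<dots> = four_block_mat (A ^\<^sub>m Suc s * A) (A ^\<^sub>m Suc s * E) (0\<^sub>m 1 n) (0\<^sub>m 1 1)"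
      unfolding N_def
      by (subst mult_four_block_mat[where ?nr1.0 = n and ?n1.0 = n and ?n2.0 = 1 and ?nr2.0 = 1 and ?nc1.0 = n and ?nc2.0 = 1])
        (use A E in \<open>auto intro!: cong_four_block_mat simp del: pow_mat.simps\<close>)
    finally show ?case by simp
  qed
  then have "N ^\<^sub>m Suc r = four_block_mat (0\<^sub>m n n) (0\<^sub>m n 1) (0\<^sub>m 1 n) (0\<^sub>m 1 1)"
    using r A E by simp
  also have "\<dots> = 0\<^sub>m (Suc n) (Suc n)" by (intro eq_matI) auto
  finally have "B ^\<^sub>m Suc r = 0\<^sub>m (Suc n) (Suc n)"
    using pow[of "Suc r"] right_mult_zero_mat[OF carr(2)[OF W], of "Suc n"]
      left_mult_zero_mat[OF carr(2)[of "- W"], of "Suc n"] W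
    by (simp del: pow_mat.simps)
  then show ?thesis using B unfolding B_def nilpotent_mat_def by blast
qed

text \<open>
  The cofactors of the bordered matrix yield \<open>z\<close> times all cofactors of \<open>A\<close> from \<open>ps\<close>, hence every
  polynomial of degree at most \<open>n\<close> without constant term, and one polynomial with nonzero constant
  term. Avoiding \<open>(j, k)\<close> in \<open>ps\<close> matters because that entry is changed by \<open>- b\<close> and may vanish in
  the bordered matrix.
\<close>

lemma bordered_charcof_span:
  fixes A :: "real Matrix.mat" and b :: real
  assumes A: "A \<in> carrier_mat n n" and jk: "j < n" "k < n" "j \<noteq> k" and b: "b \<noteq> 0"
    and ps: "set ps \<subseteq> {..<n} \<times> {..<n}" "\<And>p. p \<in> set ps \<Longrightarrow> A $$ p \<noteq> 0" "(j, k) \<notin> set ps"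
    and spanA: "\<And>q. (\<And>i. n \<le> i \<Longrightarrow> coeff q i = 0) \<Longrightarrow>
      \<exists>c. q = (\<Sum>p\<in>set ps. Polynomial.smult (c p) (charcof A p))"
    and w: "w < n" "A $$ (k, w) \<noteq> 0" "Determinant.det (mat_delete A j w) \<noteq> 0"
    and q: "\<And>i. Suc n \<le> i \<Longrightarrow> coeff q i = 0"
  defines "B \<equiv> bordered_mat n A j k b"
  shows "\<exists>c. q = (\<Sum>p\<in>{p \<in> {..<Suc n} \<times> {..<Suc n}. B $$ p \<noteq> 0}. Polynomial.smult (c p) (charcof B p))"
proof -
  note idx = bordered_mat_index[OF A jk, where b = b, folded B_def]
  note block = charcof_bordered_block[OF A jk, where b = b, folded B_def]
  note last = charcof_bordered_last[OF A jk, where b = b, folded B_def]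
  define N where "N = {p \<in> {..<Suc n} \<times> {..<Suc n}. B $$ p \<noteq> 0}"
  have N: "finite N" by (simp add: N_def)
  define Sp where "Sp q \<longleftrightarrow> (\<exists>c. q = (\<Sum>p\<in>N. Polynomial.smult (c p) (charcof B p)))" for q
  have add: "Sp (f + g)" if "Sp f" "Sp g" for f g
  proof -
    from that obtain c d where "f = (\<Sum>p\<in>N. Polynomial.smult (c p) (charcof B p))"
      "g = (\<Sum>p\<in>N. Polynomial.smult (d p) (charcof B p))" unfolding Sp_def by auto
    then have "f + g = (\<Sum>p\<in>N. Polynomial.smult (c p + d p) (charcof B p))"
      by (simp add: smult_add_left sum.distrib)
    then show ?thesis unfolding Sp_def by (rule exI[of _ "\<lambda>p. c p + d p"])
  qed
  have smult: "Sp (Polynomial.smult a f)" if "Sp f" for a f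
  proof -
    from that obtain c where "f = (\<Sum>p\<in>N. Polynomial.smult (c p) (charcof B p))"
      unfolding Sp_def by auto
    then have "Polynomial.smult a f = (\<Sum>p\<in>N. Polynomial.smult (a * c p) (charcof B p))"
      by (simp add: smult_sum2)
    then show ?thesis unfolding Sp_def by (rule exI[of _ "\<lambda>p. a * c p"])
  qed
  have zero: "Sp 0"
    unfolding Sp_def by (rule exI[of _ "\<lambda>_. 0"]) simp
  have mem: "Sp (charcof B p)" if "p \<in> N" for p
  proof -
    have "charcof B p = (\<Sum>x\<in>N. if x = p then charcof B x else 0)"
      using N that by simp
    also have "\<dots> = (\<Sum>x\<in>N. Polynomial.smult (if x = p then 1 else 0) (charcof B x))"
      by (intro sum.cong) auto
    finally show ?thesis
      unfolding Sp_def by (rule exI[of _ "\<lambda>x. if x = p then 1 else 0"])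
  qed
  have sum: "Sp (\<Sum>p\<in>I. f p)" if "finite I" "\<And>p. p \<in> I \<Longrightarrow> Sp (f p)" for I :: "(nat \<times> nat) set" and f
    using that by (induction I rule: finite_induct) (auto intro: zero add)
  have row: "Sp (charcof A (j, v))" if "v < n" "A $$ (k, v) \<noteq> 0" for v
  proof -
    have "(n, v) \<in> N" using that b by (simp add: N_def idx)
    from mem[OF this] show ?thesis by (simp add: last that)
  qed
  have times_z: "Sp ([:0, 1:] * charcof A p)" if p: "p \<in> set ps" for p
  proof -
    obtain u v where uv: "p = (u, v)" "u < n" "v < n" using p ps(1) by auto
    have "(u, v) \<noteq> (j, k)" using p ps(3) uv by auto
    then have "(u, v) \<in> N" using ps(2)[OF p] uv by (auto simp: N_def idx)
    from mem[OF this] have *: "Sp (charcof B (u, v))" .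
    show ?thesis
    proof (cases "u = k")
      case True
      have "[:0, 1:] * charcof A p = charcof B (u, v) + Polynomial.smult b (charcof A (j, v))"
        unfolding uv(1) block[OF uv(3,2)] using True by simp
      moreover have "Sp (charcof A (j, v))"
        using ps(2)[OF p] uv True by (intro row) auto
      ultimately show ?thesis using add[OF * smult] by simp
    next
      case False
      then show ?thesis using * unfolding uv(1) block[OF uv(3,2)] by simp
    qed
  qed
  have z: "Sp ([:0, 1:] * f)" if f: "\<And>i. n \<le> i \<Longrightarrow> coeff f i = 0" for f
  proof -
    obtain c where c: "f = (\<Sum>p\<in>set ps. Polynomial.smult (c p) (charcof A p))"
      using spanA[OF f] by blast
    have zf: "[:0, 1:] * f = (\<Sum>p\<in>set ps. Polynomial.smult (c p) ([:0, 1:] * charcof A p))"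
      unfolding c sum_distrib_left by (intro sum.cong refl) (rule mult_smult_right)
    show ?thesis unfolding zf by (intro sum smult times_z) simp_all
  qed
  define h where "h = charcof A (j, w)"
  have h0: "coeff h 0 \<noteq> 0"
    unfolding h_def by (rule charcof_coeff_0[OF A jk(1) w(1,3)])
  \<comment> \<open>\<open>g\<close> is \<open>q\<close> with its constant term removed by a multiple of \<open>h\<close>, hence divisible by \<open>z\<close>.\<close>
  define g where "g = q - Polynomial.smult (coeff q 0 / coeff h 0) h"
  obtain a f where af: "g = pCons a f" by (cases g)
  have "coeff g 0 = 0" using h0 by (simp add: g_def)
  then have gf: "g = [:0, 1:] * f" using af by simp
  have "coeff f i = 0" if "n \<le> i" for i
  proof -
    have "coeff f i = coeff g (Suc i)" by (simp add: af)
    also have "\<dots> = 0"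
      using q[of "Suc i"] charcof_coeff_ge[OF A jk(1) w(1), of "Suc i"] that by (simp add: g_def h_def)
    finally show ?thesis .
  qed
  then have "Sp g" unfolding gf by (rule z)
  moreover have "Sp h" unfolding h_def using w by (intro row)
  moreover have "q = g + Polynomial.smult (coeff q 0 / coeff h 0) h" by (simp add: g_def)
  ultimately have "Sp q" using add smult by metis
  then show ?thesis unfolding Sp_def N_def .
qed

theorem theorem3p1:
  fixes n j k :: nat
    and \<A> :: "sgn_entry Matrix.mat"
    and A B :: "real Matrix.mat"
    and b :: real
  assumes "sign_pattern n \<A>"
    and "A \<in> qual_class \<A>"
    and "nilpotent_mat n A"
    and "allows_full_rank_jacobian n A"
    and "j < n" and "k < n" and "j \<noteq> k"
    and "\<exists>ps. full_rank_choice n A ps \<and> (j, k) \<notin> set ps"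
    and "b \<noteq> 0"
    and "\<exists>v < n. A $$ (k, v) \<noteq> 0 \<and> Determinant.det (mat_delete A j v) \<noteq> 0"
    and "B = bordered_mat n A j k b"
  shows "nilpotent_mat (n + 1) B \<and> allows_full_rank_jacobian (n + 1) B \<and>
    (\<forall>\<S>. superpattern \<S> (sgn_mat B) \<longrightarrow> spectrally_arbitrary (n + 1) \<S>)"
proof -
  note jk = assms(5-7)
  have A: "A \<in> carrier_mat n n" using assms(3) by (simp add: nilpotent_mat_def)
  have B: "B \<in> carrier_mat (Suc n) (Suc n)"
    unfolding assms(11) by (rule bordered_mat_carrier[OF A])
  have nil: "nilpotent_mat (Suc n) B"
    unfolding assms(11) by (rule nilpotent_bordered[OF assms(3) jk])
  obtain ps where ps: "full_rank_choice n A ps" "(j, k) \<notin> set ps" using assms(8) by blast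
  then have ps_dist: "distinct ps" and ps_sub: "set ps \<subseteq> {..<n} \<times> {..<n}"
    and ps_nz: "\<And>p. p \<in> set ps \<Longrightarrow> A $$ p \<noteq> 0"
    and ps_rank: "vec_space.rank n (jacobian n A ps) = n"
    by (auto simp: full_rank_choice_def)
  obtain w where w: "w < n" "A $$ (k, w) \<noteq> 0" "Determinant.det (mat_delete A j w) \<noteq> 0"
    using assms(10) by blast
  \<comment> \<open>All nonzero positions of \<open>B\<close> are replaced by variables; more variables can only enlarge the
    span.\<close>
  define N where "N = {p \<in> {..<Suc n} \<times> {..<Suc n}. B $$ p \<noteq> 0}"
  have span: "\<exists>c. q = (\<Sum>p\<in>N. Polynomial.smult (c p) (charcof B p))"
    if "\<And>i. Suc n \<le> i \<Longrightarrow> coeff q i = 0" for q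
    unfolding N_def assms(11)
  proof (rule bordered_charcof_span[OF A jk assms(9) ps_sub ps_nz ps(2) _ w that])
    show "\<exists>c. q = (\<Sum>p\<in>set ps. Polynomial.smult (c p) (charcof A p))"
      if "\<And>i. n \<le> i \<Longrightarrow> coeff q i = 0" for q
      using full_rank_jacobian_iff[OF A ps_dist ps_sub] ps_rank that by blast
  qed
  have "finite N" by (simp add: N_def)
  then obtain qs where qs: "set qs = N" "distinct qs"
    using finite_distinct_list by blast
  have qs_sub: "set qs \<subseteq> {..<Suc n} \<times> {..<Suc n}" by (auto simp: qs N_def)
  have rank: "vec_space.rank (Suc n) (jacobian (Suc n) B qs) = Suc n"
    using full_rank_jacobian_iff[OF B qs(2) qs_sub] span unfolding qs(1) by blast
  moreover have "jacobian (Suc n) B qs \<in> carrier_mat (Suc n) (length qs)"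
    by (simp add: jacobian_def Let_def)
  ultimately have "Suc n \<le> length qs"
    using vec_space.rank_le_nc by metis
  then have "full_rank_choice (Suc n) B qs"
    using qs rank by (auto simp: full_rank_choice_def N_def)
  then have "allows_full_rank_jacobian (Suc n) B"
    unfolding allows_full_rank_jacobian_def by blast
  moreover have "spectrally_arbitrary (Suc n) \<S>" if "superpattern \<S> (sgn_mat B)" for \<S>
    by (rule superpattern_spectrally_arbitrary[OF _ B nilpotent_char_poly[OF nil] span[unfolded N_def] that])
      simp_all
  ultimately show ?thesis using nil by simp
qed

end
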